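(* For every $n\ge2$ there is a constant $K>0$ depending only on $n$ such that the following holds. Let $\mathcal G=(V,E)$ be a connected, non-bipartite undirected graph with $V=[n]$, let $X_1,\dots,X_n$ be pairwise distinct real numbers with ranks $r_1,\dots,r_n$, let $\{X_1,\dots,X_n\}=S_1\cup S_2$ be a partition into two disjoint subsets, and let $t_n=\sum_{k=1}^n r_kb_k$ with $b_k=\mathbb I_{\{X_k\in S_1\}}$ be the Wilcoxon statistic. Let $\boldsymbol Z(t)$ be the (synchronous) gossip estimate defined in the context, with $f=\mathrm{id}$ and $g(X_k)=\mathbb I_{\{X_k\in S_1\}}$. Then there exists $T^*$ such that for every integer $t>T^*$, $$\big\|\mathbb E[\boldsymbol Z(t)]-t_n\mathbf 1_n\big\|\le\frac{K}{c^2t},$$ where $c$ is the second smallest eigenvalue of $\mathbf L(P)=\sum_{e\in E}p_e\mathbf L_e$.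
   Context: Graph and edge sampling: $\mathcal G=(V,E)$ is a connected, non-bipartite undirected graph on $V=[n]=\{1,\dots,n\}$, $n\ge2$; $d_i$ is the degree of node $i$. Node $k$ holds the (fixed) real number $X_k$, with no ties. Edges $e_1,e_2,\dots$ are drawn i.i.d. from $E$, with edge $e=(i,j)$ having probability $p_e=\frac1n\left(\frac1{d_i}+\frac1{d_j}\right)$. For $e=(i,j)$ let $\mathbf L_e=(\mathbf e_i-\mathbf e_j)(\mathbf e_i-\mathbf e_j)^\top$, where $\mathbf e_1,\dots,\mathbf e_n$ is the canonical basis. Put $\mathbf W_1(s)=\mathbf I_n-\mathbf L_{e_s}$ (swapping matrix) and $\mathbf W_2(s)=\mathbf I_n-\frac12\mathbf L_{e_s}$ (averaging matrix). $\|\cdot\|$ is the Euclidean norm and $\mathbf 1_n$ the all-ones vector; $\odot$ is the entrywise product. Ranks: $r_k=1+\sum_{l=1}^n\mathbb I_{\{X_k>X_l\}}$. Synchronous rank estimates (all nodes update at every step): $Y_k(0)=X_k$, $\mathbf Y(s)=\mathbf W_1(s)\mathbf Y(s-1)$ for $s\ge1$, and $$R_k(t)=1+\frac nt\sum_{s=1}^t\mathbb I_{\{X_k>Y_k(s-1)\}},\qquad t\ge1 .$$ Gossip estimation of a rank-based statistic $\sum_kf(r_k)g(X_k)$: $W_k(0)=0$, $W_k(t)=n\,f(R_k(t))$ for $t\ge1$, $\delta_k(t)=W_k(t)-W_k(t-1)$, $\tilde{\boldsymbol X}=(g(X_1),\dots,g(X_n))^\top$, $\boldsymbol Z(0)=0$,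 and for $t\ge1$ $$\boldsymbol Z(t)=\mathbf W_2(t)\big(\boldsymbol Z(t-1)+\boldsymbol\delta(t)\odot\tilde{\boldsymbol X}\big),$$ the same edge $e_t$ being used for averaging at step $t$ and for the swap of auxiliary observations. *)

theory Defs
  imports
    "HOL-Probability.Probability_Mass_Function"
    "HOL-Probability.Infinite_Product_Measure"
    "Jordan_Normal_Form.Char_Poly"
begin

unbundle no vec_syntax
unbundle no inner_syntax

text \<open>
  The \<open>n\<close> nodes are \<open>0, \<dots>, n - 1\<close>, matching the indices of vectors and matrices of
  dimension \<open>n\<close>. An undirected edge is the two-element set of its endpoints.
\<close>

definition simple_graph :: "nat \<Rightarrow> nat set set \<Rightarrow> bool" where
  "simple_graph n E \<longleftrightarrow> (\<forall>e\<in>E. e \<subseteq> {..<n} \<and> card e = 2)"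

definition connected_graph :: "nat \<Rightarrow> nat set set \<Rightarrow> bool" where
  "connected_graph n E \<longleftrightarrow> (\<forall>i<n. \<forall>j<n. (i, j) \<in> {(u, v). {u, v} \<in> E}\<^sup>*)"

definition bipartite_graph :: "nat \<Rightarrow> nat set set \<Rightarrow> bool" where
  "bipartite_graph n E \<longleftrightarrow>
     (\<exists>A B. A \<union> B = {..<n} \<and> A \<inter> B = {} \<and> (\<forall>e\<in>E. e \<inter> A \<noteq> {} \<and> e \<inter> B \<noteq> {}))"

definition node_degree :: "nat set set \<Rightarrow> nat \<Rightarrow> nat" where
  "node_degree E i = card {e \<in> E. i \<in> e}"

definition edge_prob :: "nat \<Rightarrow> nat set set \<Rightarrow> nat set \<Rightarrow> real" where
  "edge_prob n E e = 1 / real n * (\<Sum>i\<in>e. 1 / real (node_degree E i))"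

text \<open>
  The weights sum to one as soon as there are no isolated nodes; see \<open>pmf_edge_pmf\<close> below.
\<close>

definition edge_pmf :: "nat \<Rightarrow> nat set set \<Rightarrow> nat set pmf" where
  "edge_pmf n E = embed_pmf (\<lambda>e. if e \<in> E then edge_prob n E e else 0)"

definition edge_sequences :: "nat \<Rightarrow> nat set set \<Rightarrow> (nat \<Rightarrow> nat set) measure" where
  "edge_sequences n E = PiM {1..} (\<lambda>_. measure_pmf (edge_pmf n E))"

text \<open>
  \<open>Min\<close> and \<open>Max\<close> merely name the two endpoints of an edge; the matrix does not depend on
  their order.
\<close>

definition edge_laplacian :: "nat \<Rightarrow> nat set \<Rightarrow> real mat" where
  "edge_laplacian n e =
     (let u = unit_vec n (Min e) - unit_vec n (Max e)
      in mat_of_cols n [u] * mat_of_rows n [u])"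

definition swapping_matrix :: "nat \<Rightarrow> nat set \<Rightarrow> real mat" where
  "swapping_matrix n e = 1\<^sub>m n - edge_laplacian n e"

definition averaging_matrix :: "nat \<Rightarrow> nat set \<Rightarrow> real mat" where
  "averaging_matrix n e = 1\<^sub>m n - (1 / 2) \<cdot>\<^sub>m edge_laplacian n e"

definition weighted_laplacian :: "nat \<Rightarrow> nat set set \<Rightarrow> real mat" where
  "weighted_laplacian n E =
     mat n n (\<lambda>(i, j). \<Sum>e\<in>E. edge_prob n E e * edge_laplacian n e $$ (i, j))"

text \<open>
  Eigenvalues are counted with algebraic multiplicity. The definition is meant for real
  symmetric matrices, whose characteristic polynomial splits over the reals, of dimension
  at least two.
\<close>

definition second_smallest_eigenvalue :: "real mat \<Rightarrow> real" where
  "second_smallest_eigenvalue A = sorted_list_of_multiset (proots (char_poly A)) ! 1"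

definition obs_rank :: "nat \<Rightarrow> (nat \<Rightarrow> real) \<Rightarrow> nat \<Rightarrow> nat" where
  "obs_rank n X k = 1 + (\<Sum>l<n. of_bool (X k > X l))"

definition wilcoxon :: "nat \<Rightarrow> (nat \<Rightarrow> real) \<Rightarrow> real set \<Rightarrow> real" where
  "wilcoxon n X S = (\<Sum>k<n. real (obs_rank n X k) * of_bool (X k \<in> S))"

text \<open>
  Below, \<open>e :: nat \<Rightarrow> nat set\<close> is a realisation of the edge sequence, \<open>e s\<close> being the edge
  drawn at step \<open>s \<ge> 1\<close>.
\<close>

primrec swapped_obs :: "nat \<Rightarrow> (nat \<Rightarrow> real) \<Rightarrow> (nat \<Rightarrow> nat set) \<Rightarrow> nat \<Rightarrow> real vec" where
  "swapped_obs n X e 0 = vec n X"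
| "swapped_obs n X e (Suc s) = swapping_matrix n (e (Suc s)) *\<^sub>v swapped_obs n X e s"

definition rank_estimate ::
  "nat \<Rightarrow> (nat \<Rightarrow> real) \<Rightarrow> (nat \<Rightarrow> nat set) \<Rightarrow> nat \<Rightarrow> nat \<Rightarrow> real" where
  "rank_estimate n X e k t =
     1 + real n / real t * (\<Sum>s=1..t. of_bool (X k > swapped_obs n X e (s - 1) $ k))"

definition gossip_weight ::
  "nat \<Rightarrow> (real \<Rightarrow> real) \<Rightarrow> (nat \<Rightarrow> real) \<Rightarrow> (nat \<Rightarrow> nat set) \<Rightarrow> nat \<Rightarrow> nat \<Rightarrow> real" where
  "gossip_weight n f X e k t = (if t = 0 then 0 else real n * f (rank_estimate n X e k t))"

definition gossip_increment ::
  "nat \<Rightarrow> (real \<Rightarrow> real) \<Rightarrow> (nat \<Rightarrow> real) \<Rightarrow> (nat \<Rightarrow> nat set) \<Rightarrow> nat \<Rightarrow> nat \<Rightarrow> real" where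
  "gossip_increment n f X e k t = gossip_weight n f X e k t - gossip_weight n f X e k (t - 1)"

primrec gossip_estimate ::
  "nat \<Rightarrow> (real \<Rightarrow> real) \<Rightarrow> (real \<Rightarrow> real) \<Rightarrow> (nat \<Rightarrow> real) \<Rightarrow> (nat \<Rightarrow> nat set) \<Rightarrow> nat \<Rightarrow> real vec"
where
  "gossip_estimate n f g X e 0 = 0\<^sub>v n"
| "gossip_estimate n f g X e (Suc t) =
     averaging_matrix n (e (Suc t)) *\<^sub>v
       (gossip_estimate n f g X e t + vec n (\<lambda>k. gossip_increment n f X e k (Suc t) * g (X k)))"

definition expected_gossip_estimate ::
  "nat \<Rightarrow> nat set set \<Rightarrow> (real \<Rightarrow> real) \<Rightarrow> (real \<Rightarrow> real) \<Rightarrow> (nat \<Rightarrow> real) \<Rightarrow> nat \<Rightarrow> real vec" where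
  "expected_gossip_estimate n E f g X t =
     vec n (\<lambda>k. \<integral>e. gossip_estimate n f g X e t $ k \<partial>edge_sequences n E)"

definition euclidean_norm :: "real vec \<Rightarrow> real" where
  "euclidean_norm v = sqrt (v \<bullet> v)"

lemma edge_prob_nonneg: "edge_prob n E e \<ge> 0"
  by (simp add: edge_prob_def sum_nonneg)

lemma simple_graph_finite: "simple_graph n E \<Longrightarrow> finite E"
  by (rule finite_subset[of _ "Pow {..<n}"]) (auto simp: simple_graph_def)

lemma node_degree_pos:
  assumes "n \<ge> 2" "simple_graph n E" "connected_graph n E" "i < n"
  shows "node_degree E i > 0"
proof -
  obtain j where j: "j < n" "j \<noteq> i"
  proof (cases "i = 0")
    case True
    with assms(1) that[of 1] show thesis by simp
  next
    case False
    with assms(1) that[of 0] show thesis by simp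
  qed
  with assms(3,4) have "(i, j) \<in> {(u, v). {u, v} \<in> E}\<^sup>*"
    by (simp add: connected_graph_def)
  with j(2) obtain v where "{i, v} \<in> E"
    by (auto elim: converse_rtranclE)
  moreover have "finite {e \<in> E. i \<in> e}"
    using simple_graph_finite[OF assms(2)] by simp
  ultimately show ?thesis
    by (auto simp: node_degree_def card_gt_0_iff)
qed

lemma sum_edge_prob:
  assumes "n \<ge> 2" "simple_graph n E" "connected_graph n E"
  shows "(\<Sum>e\<in>E. edge_prob n E e) = 1"
proof -
  have fin: "finite E" using simple_graph_finite[OF assms(2)] .
  have sub: "e \<subseteq> {..<n}" if "e \<in> E" for e
    using assms(2) that by (simp add: simple_graph_def)
  let ?w = "\<lambda>i. 1 / real (node_degree E i)"
  have "(\<Sum>e\<in>E. \<Sum>i\<in>e. ?w i) = (\<Sum>e\<in>E. \<Sum>i\<in>{i \<in> {..<n}. i \<in> e}. ?w i)"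
    using sub by (intro sum.cong) auto
  also have "\<dots> = (\<Sum>i<n. \<Sum>e\<in>{e \<in> E. i \<in> e}. ?w i)"
    by (rule sum.swap_restrict) (use fin in auto)
  also have "\<dots> = (\<Sum>i<n. 1)"
  proof (rule sum.cong[OF refl])
    fix i assume "i \<in> {..<n}"
    then have "node_degree E i > 0" using node_degree_pos[OF assms] by simp
    then show "(\<Sum>e\<in>{e \<in> E. i \<in> e}. ?w i) = 1"
      by (simp add: node_degree_def)
  qed
  finally show ?thesis
    using assms(1) by (simp add: edge_prob_def sum_divide_distrib[symmetric])
qed

lemma pmf_edge_pmf:
  assumes "n \<ge> 2" "simple_graph n E" "connected_graph n E"
  shows "pmf (edge_pmf n E) e = (if e \<in> E then edge_prob n E e else 0)"
  unfolding edge_pmf_def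
proof (rule pmf_embed_pmf)
  let ?p = "\<lambda>e. if e \<in> E then edge_prob n E e else 0"
  have fin: "finite E" using simple_graph_finite[OF assms(2)] .
  have "(\<integral>\<^sup>+e. ennreal (?p e) \<partial>count_space UNIV) = (\<Sum>e\<in>E. ennreal (?p e))"
    using fin by (intro nn_integral_count_space') auto
  also have "\<dots> = ennreal (\<Sum>e\<in>E. edge_prob n E e)"
    by (subst sum_ennreal[symmetric]) (auto simp: edge_prob_nonneg)
  also have "\<dots> = 1" by (simp add: sum_edge_prob[OF assms])
  finally show "(\<integral>\<^sup>+e. ennreal (?p e) \<partial>count_space UNIV) = 1" .
qed (simp add: edge_prob_nonneg)

lemma edge_laplacian_index:
  assumes "a < n" "b < n" "i \<noteq> j" "i < n" "j < n"
  shows "edge_laplacian n {i, j} $$ (a, b) =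
    (of_bool (a = i) - of_bool (a = j)) * (of_bool (b = i) - of_bool (b = j))"
  using assms
  by (auto simp: edge_laplacian_def Let_def scalar_prod_def mat_of_cols_def mat_of_rows_def
      min_def max_def unit_vec_def)

end

theory Submission
  imports Defs "Jordan_Normal_Form.Schur_Decomposition" "HOL-Probability.Independent_Family"
begin

unbundle no vec_syntax
unbundle no inner_syntax

text \<open>
  Let \<open>L\<close> be the weighted Laplacian. The increment at step \<open>t\<close> depends on the edges drawn before
  step \<open>t\<close> only, so the expected estimate obeys the linear recursion
  \<open>z(t) = (I - L/2) (z(t-1) + d(t))\<close> with \<open>d(t) = O(1/t)\<close>. On vectors of mean zero
  \<open>I - L/2\<close> is a strict contraction by the Poincare inequality, so the mean-zero part of \<open>z(t)\<close> is
  \<open>O(1/t)\<close>. The sum of the entries of \<open>z(t)\<close> telescopes to \<open>n\<close> times the sum over the nodes in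
  the first sample of the expected rank estimates. The error of the latter is \<open>n/t\<close> times a partial
  sum of powers of \<open>I - L\<close> applied to a mean-zero vector, and these partial sums are bounded.
  The constants obtained depend on the graph but not on the observations; since there are
  finitely many graphs on \<open>n\<close> nodes and \<open>c \<noteq> 0\<close> for each connected one, they can be absorbed
  into \<open>K\<close>.
\<close>

section \<open>The second smallest eigenvalue of a symmetric matrix\<close>

text \<open>For an eigenvector \<open>v\<close>, the form \<open>q\<close> of \<open>v\<close>
  equals \<open>a\<close> times the squared norm of \<open>v\<close>. Symmetry and real entries make
  \<open>q\<close> its own conjugate, and the squared norm is not zero.\<close>

lemma symmetric_complex_eigenvalue_real:
  fixes A :: "real mat"
  assumes A: "A \<in> carrier_mat n n" and sym: "transpose_mat A = A"
    and ev: "eigenvalue (map_mat complex_of_real A) a"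
  shows "complex_of_real (Re a) = a"
proof -
  obtain v where v: "v \<in> carrier_vec n" "v \<noteq> 0\<^sub>v n"
    and eq: "map_mat complex_of_real A *\<^sub>v v = a \<cdot>\<^sub>v v"
    using ev A by (auto simp: eigenvalue_def eigenvector_def)
  define q where "q = (\<Sum>i<n. \<Sum>j<n. cnj (v $ i) * of_real (A $$ (i, j)) * v $ j)"
  define N where "N = (\<Sum>i<n. (cmod (v $ i))\<^sup>2)"
  have A_sym: "A $$ (i, j) = A $$ (j, i)" if "i < n" "j < n" for i j
    using that A by (subst sym[symmetric]) simp
  have row: "(\<Sum>j<n. of_real (A $$ (i, j)) * v $ j) = a * v $ i" if "i < n" for i
    using arg_cong[OF eq, of "\<lambda>w. w $ i"] that A v(1)
    by (simp add: scalar_prod_def lessThan_atLeast0)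
  have "q = (\<Sum>i<n. cnj (v $ i) * (\<Sum>j<n. of_real (A $$ (i, j)) * v $ j))"
    unfolding q_def by (simp add: sum_distrib_left mult.assoc)
  also have "\<dots> = (\<Sum>i<n. a * (v $ i * cnj (v $ i)))"
    by (intro sum.cong refl, subst row) (simp_all add: mult_ac)
  also have "\<dots> = a * of_real N"
    unfolding N_def of_real_sum sum_distrib_left
    by (intro sum.cong refl) (simp only: complex_norm_square)
  finally have q: "q = a * of_real N" .
  have "cnj q = (\<Sum>i<n. \<Sum>j<n. v $ i * of_real (A $$ (i, j)) * cnj (v $ j))"
    unfolding q_def by simp
  also have "\<dots> = (\<Sum>j<n. \<Sum>i<n. v $ i * of_real (A $$ (i, j)) * cnj (v $ j))"
    by (rule sum.swap)
  also have "\<dots> = q"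
    unfolding q_def by (intro sum.cong refl) (simp add: A_sym mult_ac)
  finally have "cnj q = q" .
  moreover have "N \<noteq> 0"
  proof
    assume "N = 0"
    then have "\<forall>i<n. v $ i = 0"
      unfolding N_def by (subst (asm) sum_nonneg_eq_0_iff) auto
    with v show False by (auto intro: eq_vecI)
  qed
  ultimately have "cnj a = a" by (simp add: q)
  then show ?thesis by (simp add: complex_eq_iff)
qed

text \<open>Over the complex numbers the polynomial factors, and all its roots are eigenvalues,
  hence real. The factorization is then pulled back along the injective embedding of the
  reals.\<close>

lemma symmetric_char_poly_splits:
  fixes A :: "real mat"
  assumes A: "A \<in> carrier_mat n n" and sym: "transpose_mat A = A"
  shows "\<exists>es. char_poly A = (\<Prod>e\<leftarrow>es. [:- e, 1:]) \<and> length es = n"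
proof -
  let ?C = "map_mat complex_of_real A"
  have C: "?C \<in> carrier_mat n n" using A by simp
  obtain as where as: "char_poly ?C = (\<Prod>a\<leftarrow>as. [:- a, 1:])" "length as = n"
    using char_poly_factorized[OF C] by blast
  have real: "complex_of_real (Re a) = a" if "a \<in> set as" for a
  proof (rule symmetric_complex_eigenvalue_real[OF A sym])
    show "eigenvalue ?C a"
      unfolding eigenvalue_root_char_poly[OF C] as(1) poly_prod_list prod_list_zero_iff
      using that by force
  qed
  let ?es = "map Re as"
  interpret h: map_poly_inj_idom_hom complex_of_real ..
  have "map_poly complex_of_real (char_poly A) = (\<Prod>a\<leftarrow>as. [:- a, 1:])"
    using of_real_hom.char_poly_hom[OF A] as(1) by metis
  also have "\<dots> = (\<Prod>a\<leftarrow>as. map_poly complex_of_real [:- Re a, 1:])"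
    by (intro arg_cong[of _ _ prod_list] map_cong refl) (simp add: real)
  also have "\<dots> = map_poly complex_of_real (\<Prod>e\<leftarrow>?es. [:- e, 1:])"
    by (simp add: h.hom_prod_list o_def)
  finally have "char_poly A = (\<Prod>e\<leftarrow>?es. [:- e, 1:])"
    by (simp only: h.eq_iff)
  with as(2) show ?thesis by (intro exI[of _ ?es]) simp
qed

lemma proots_prod_linear_factors:
  "proots (\<Prod>e\<leftarrow>es. [:- e, 1:]) = mset (es :: 'a :: idom list)"
proof (induction es)
  case (Cons e es)
  have "(\<Prod>e\<leftarrow>es. [:- e, 1:]) \<noteq> 0"
    by (auto simp: prod_list_zero_iff)
  then have "proots ([:- e, 1:] * (\<Prod>e\<leftarrow>es. [:- e, 1:])) = mset (e # es)"
    by (subst proots_mult) (auto simp: Cons.IH)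
  then show ?case by (simp del: mult_pCons_left)
qed simp

lemma mult_mat_zero_vec:
  "A \<in> carrier_mat m n \<Longrightarrow> A *\<^sub>v 0\<^sub>v n = (0\<^sub>v m :: 'a :: semiring_0 vec)"
  by (intro eq_vecI) (auto simp: scalar_prod_def)

text \<open>The squared norm of \<open>A v\<close> is the scalar product of \<open>v\<close> with
  \<open>A (A v)\<close>. This excludes a nontrivial Jordan block at the eigenvalue 0.\<close>

lemma symmetric_kernel_square:
  fixes A :: "real mat"
  assumes A: "A \<in> carrier_mat n n" and sym: "transpose_mat A = A"
    and v: "v \<in> carrier_vec n" and zero: "A *\<^sub>v (A *\<^sub>v v) = 0\<^sub>v n"
  shows "A *\<^sub>v v = 0\<^sub>v n"
proof -
  have "(A *\<^sub>v v) \<bullet> (A *\<^sub>v v) = v \<bullet> (A *\<^sub>v (A *\<^sub>v v))"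
    using transpose_vec_mult_scalar[OF A v, of "A *\<^sub>v v"] A v sym
    by (metis comm_scalar_prod mult_mat_vec_carrier transpose_vec_mult_scalar)
  with zero v have "(A *\<^sub>v v) \<bullet> (A *\<^sub>v v) = 0" by simp
  then show ?thesis
    using conjugate_square_eq_0_vec[of "A *\<^sub>v v" n] A v by auto
qed

text \<open>If the second eigenvalue were 0, so would be the first, since none is negative.
  Triangularization then gives two independent vectors killed by \<open>A\<close> or its square,
  hence by \<open>A\<close>. The kernel, however, consists of constant vectors, which are pairwise
  dependent.\<close>

lemma second_smallest_eigenvalue_nonzero:
  fixes A :: "real mat"
  assumes A: "A \<in> carrier_mat n n" and sym: "transpose_mat A = A" and n: "n \<ge> 2"
    and psd: "\<And>v. v \<in> carrier_vec n \<Longrightarrow> v \<bullet> (A *\<^sub>v v) \<ge> 0"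
    and ker: "\<And>v i j. \<lbrakk>v \<in> carrier_vec n; A *\<^sub>v v = 0\<^sub>v n; i < n; j < n\<rbrakk> \<Longrightarrow> v $ i = v $ j"
  shows "second_smallest_eigenvalue A \<noteq> 0"
proof
  assume contr: "second_smallest_eigenvalue A = 0"
  define es where "es = sorted_list_of_multiset (proots (char_poly A))"
  obtain es' where es': "char_poly A = (\<Prod>e\<leftarrow>es'. [:- e, 1:])" "length es' = n"
    using symmetric_char_poly_splits[OF A sym] by blast
  have mset: "mset es = mset es'"
    by (simp add: es_def es' proots_prod_linear_factors)
  then have len: "length es = n" using es'(2) mset_eq_length by metis
  have cp: "char_poly A = (\<Prod>e\<leftarrow>es. [:- e, 1:])"
    unfolding es'(1) prod_mset_prod_list[symmetric] mset_map mset ..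
  have nonneg: "e \<ge> 0" if e: "e \<in> set es" for e
  proof -
    have "eigenvalue A e"
      unfolding eigenvalue_root_char_poly[OF A] cp poly_prod_list prod_list_zero_iff
      using e by force
    then obtain v where v: "v \<in> carrier_vec n" "v \<noteq> 0\<^sub>v n" "A *\<^sub>v v = e \<cdot>\<^sub>v v"
      using A by (auto simp: eigenvalue_def eigenvector_def)
    have "v \<bullet> v > 0"
      using conjugate_square_greater_0_vec[OF v(1)] v(2) by simp
    moreover have "e * (v \<bullet> v) \<ge> 0" using psd[OF v(1)] v by simp
    ultimately show ?thesis by (simp add: zero_le_mult_iff)
  qed
  have "sorted es" by (simp add: es_def)
  have es1: "es ! 1 = 0" using contr by (simp add: second_smallest_eigenvalue_def es_def)
  have "es ! 0 \<le> es ! 1" using \<open>sorted es\<close> len n by (intro sorted_nth_mono) auto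
  moreover have "es ! 0 \<ge> 0" using nonneg len n by simp
  ultimately have es0: "es ! 0 = 0" using es1 by simp
  \<comment> \<open>The Schur form lists the eigenvalues on its diagonal in the order of
    \<open>es\<close>, so its first two diagonal entries are the two zeros.\<close>
  obtain B P Q where BPQ: "schur_decomposition A es = (B, P, Q)"
    by (cases "schur_decomposition A es") auto
  from schur_decomposition[OF A cp BPQ]
  have wit: "similar_mat_wit A B P Q" and ut: "upper_triangular B" and diag: "diag_mat B = es"
    by auto
  note d = similar_mat_witD2[OF A wit]
  have B: "B \<in> carrier_mat n n" and P: "P \<in> carrier_mat n n" and Q: "Q \<in> carrier_mat n n"
    using d by auto
  have B00: "B $$ (0, 0) = 0" and B11: "B $$ (1, 1) = 0"
    using es0 es1 n B by (auto simp: diag[symmetric] diag_mat_def)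
  have Bcol0: "B *\<^sub>v unit_vec n 0 = 0\<^sub>v n"
  proof (rule eq_vecI)
    fix i assume "i < dim_vec (0\<^sub>v n :: real vec)"
    then have i: "i < n" by simp
    then have "B $$ (i, 0) = 0"
      using B00 upper_triangularD[OF ut, of 0 i] B by (cases "i = 0") auto
    with i B n show "(B *\<^sub>v unit_vec n 0) $ i = 0\<^sub>v n $ i" by simp
  qed (use B in simp)
  have Bcol1: "B *\<^sub>v unit_vec n 1 = B $$ (0, 1) \<cdot>\<^sub>v unit_vec n 0"
  proof (rule eq_vecI)
    fix i assume "i < dim_vec (B $$ (0, 1) \<cdot>\<^sub>v unit_vec n 0 :: real vec)"
    then have i: "i < n" by simp
    have "i \<noteq> 0 \<Longrightarrow> B $$ (i, 1) = 0"
      using B11 upper_triangularD[OF ut, of 1 i] B i by (cases "i = 1") auto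
    with i B n show "(B *\<^sub>v unit_vec n 1) $ i = (B $$ (0, 1) \<cdot>\<^sub>v unit_vec n 0) $ i"
      by (cases "i = 0") auto
  qed (use B in simp)
  have AP: "A *\<^sub>v (P *\<^sub>v w) = P *\<^sub>v (B *\<^sub>v w)" if w: "w \<in> carrier_vec n" for w
  proof -
    have "A *\<^sub>v (P *\<^sub>v w) = (P * B * Q * P) *\<^sub>v w"
      using d(3) P B Q w by (metis assoc_mult_mat_vec mult_carrier_mat)
    also have "P * B * Q * P = P * B * (Q * P)" using P B Q by (metis assoc_mult_mat mult_carrier_mat)
    also have "\<dots> = P * B" using d(2) P B by simp
    also have "(P * B) *\<^sub>v w = P *\<^sub>v (B *\<^sub>v w)" using P B w by simp
    finally show ?thesis .
  qed
  define p where "p k = P *\<^sub>v unit_vec n k" for k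
  have p: "p k \<in> carrier_vec n" for k unfolding p_def using P by simp
  have Ap0: "A *\<^sub>v p 0 = 0\<^sub>v n"
    unfolding p_def AP[OF unit_vec_carrier] Bcol0 by (rule mult_mat_zero_vec[OF P])
  have "A *\<^sub>v p 1 = B $$ (0, 1) \<cdot>\<^sub>v p 0"
    unfolding p_def AP[OF unit_vec_carrier] Bcol1 using P by (simp add: mult_mat_vec)
  moreover have "B $$ (0, 1) \<cdot>\<^sub>v 0\<^sub>v n = 0\<^sub>v n" by (intro eq_vecI) simp_all
  ultimately have "A *\<^sub>v (A *\<^sub>v p 1) = 0\<^sub>v n"
    using Ap0 mult_mat_vec[OF A p, of "B $$ (0, 1)" 0] by simp
  then have Ap1: "A *\<^sub>v p 1 = 0\<^sub>v n"
    by (rule symmetric_kernel_square[OF A sym p])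
  have c0: "p 0 $ i = p 0 $ 0" and c1: "p 1 $ i = p 1 $ 0" if "i < n" for i
    using ker[OF p Ap0 that, of 0] ker[OF p Ap1 that, of 0] n by auto
  \<comment> \<open>Both vectors are constant, so cross-multiplying by their values gives the same
    vector. Applying \<open>Q\<close> turns this into a relation between two distinct unit vectors,
    which forces \<open>p 0\<close> to vanish although \<open>Q\<close> maps it to a unit
    vector.\<close>
  have dep: "p 1 $ 0 \<cdot>\<^sub>v p 0 = p 0 $ 0 \<cdot>\<^sub>v p 1"
  proof (rule eq_vecI)
    fix i assume "i < dim_vec (p 0 $ 0 \<cdot>\<^sub>v p 1)"
    then have "i < n" using p[of 1] by simp
    then show "(p 1 $ 0 \<cdot>\<^sub>v p 0) $ i = (p 0 $ 0 \<cdot>\<^sub>v p 1) $ i"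
      using p[of 0] p[of 1] c0[of i] c1[of i] by simp
  qed (use p[of 0] p[of 1] in simp)
  have Qp: "Q *\<^sub>v p k = unit_vec n k" for k
    unfolding p_def using d(2) P Q by (metis assoc_mult_mat_vec one_mult_mat_vec unit_vec_carrier)
  have "p 1 $ 0 \<cdot>\<^sub>v unit_vec n 0 = Q *\<^sub>v (p 1 $ 0 \<cdot>\<^sub>v p 0)"
    using Q p by (simp add: mult_mat_vec Qp)
  also have "\<dots> = p 0 $ 0 \<cdot>\<^sub>v unit_vec n 1"
    unfolding dep using Q p by (simp add: mult_mat_vec Qp)
  finally have "p 1 $ 0 \<cdot>\<^sub>v unit_vec n 0 = p 0 $ 0 \<cdot>\<^sub>v (unit_vec n 1 :: real vec)" .
  from arg_cong[OF this, of "\<lambda>w. w $ 1"] have "p 0 $ 0 = 0" using n by simp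
  then have "p 0 $ i = 0" if "i < n" for i using c0[OF that] by simp
  then have "p 0 = 0\<^sub>v n" using p[of 0] by (intro eq_vecI) auto
  then have "unit_vec n 0 = (0\<^sub>v n :: real vec)"
    using Qp[of 0] mult_mat_zero_vec[OF Q] by simp
  from arg_cong[OF this, of "\<lambda>w. w $ 0"] n show False by simp
qed

section \<open>Expected steps and the Poincare inequality\<close>

text \<open>Vectors are modelled as functions on the naturals read below \<open>n\<close>, so that
  sums and pointwise reasoning need no carrier conditions.\<close>

definition lap :: "nat \<Rightarrow> nat set \<Rightarrow> (nat \<Rightarrow> real) \<Rightarrow> nat \<Rightarrow> real" where
  "lap n e x i = (\<Sum>j<n. edge_laplacian n e $$ (i, j) * x j)"

definition wlap :: "nat \<Rightarrow> nat set set \<Rightarrow> (nat \<Rightarrow> real) \<Rightarrow> nat \<Rightarrow> real" where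
  "wlap n E x i = (\<Sum>e\<in>E. edge_prob n E e * lap n e x i)"

text \<open>The expected swapping matrix is the case \<open>\<theta> = 1\<close>, the expected averaging matrix \<open>\<theta> = 1 / 2\<close>.\<close>

definition mean_step :: "nat \<Rightarrow> nat set set \<Rightarrow> real \<Rightarrow> (nat \<Rightarrow> real) \<Rightarrow> nat \<Rightarrow> real" where
  "mean_step n E \<theta> x i = x i - \<theta> * wlap n E x i"

text \<open>The quadratic form of the weighted Laplacian; on a simple connected graph it is the sum
  of \<open>p_e * (x a - x b)^2\<close> over the edges \<open>e = {a, b}\<close>.\<close>

definition dirichlet :: "nat \<Rightarrow> nat set set \<Rightarrow> (nat \<Rightarrow> real) \<Rightarrow> real" where
  "dirichlet n E x = (\<Sum>i<n. x i * wlap n E x i)"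

lemma lap_edge:
  assumes "a < n" "b < n" "a \<noteq> b" "i < n"
  shows "lap n {a, b} x i = (of_bool (i = a) - of_bool (i = b)) * (x a - x b)"
proof -
  have "lap n {a, b} x i =
    (\<Sum>j<n. (of_bool (i = a) - of_bool (i = b)) * (of_bool (j = a) * x j - of_bool (j = b) * x j))"
    unfolding lap_def using assms
    by (intro sum.cong refl) (simp add: edge_laplacian_index algebra_simps)
  also have "\<dots> = (of_bool (i = a) - of_bool (i = b)) *
      ((\<Sum>j<n. of_bool (j = a) * x j) - (\<Sum>j<n. of_bool (j = b) * x j))"
    by (simp only: sum_distrib_left[symmetric] sum_subtractf)
  also have "(\<Sum>j<n. of_bool (j = a) * x j) = x a"
    using assms by (subst sum.remove[of _ a]) auto
  also have "(\<Sum>j<n. of_bool (j = b) * x j) = x b"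
    using assms by (subst sum.remove[of _ b]) auto
  finally show ?thesis .
qed

lemma lap_sum: "lap n e (\<lambda>i. \<Sum>s\<in>A. f s i) i = (\<Sum>s\<in>A. lap n e (f s) i)"
  unfolding lap_def sum_distrib_left by (rule sum.swap)

lemma wlap_sum: "wlap n E (\<lambda>i. \<Sum>s\<in>A. f s i) i = (\<Sum>s\<in>A. wlap n E (f s) i)"
  unfolding wlap_def lap_sum sum_distrib_left by (rule sum.swap)

lemma lap_diff: "lap n e (\<lambda>i. x i - y i) i = lap n e x i - lap n e y i"
  unfolding lap_def by (simp add: sum_subtractf right_diff_distrib)

lemma lap_cong: "(\<And>j. j < n \<Longrightarrow> x j = y j) \<Longrightarrow> lap n e x i = lap n e y i"
  unfolding lap_def by simp

lemma wlap_diff: "wlap n E (\<lambda>i. x i - y i) i = wlap n E x i - wlap n E y i"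
  unfolding wlap_def by (simp add: lap_diff sum_subtractf right_diff_distrib)

lemma mean_step_diff:
  "mean_step n E \<theta> (\<lambda>i. x i - y i) i = mean_step n E \<theta> x i - mean_step n E \<theta> y i"
  unfolding mean_step_def by (simp add: wlap_diff algebra_simps)

lemma mean_step_cong:
  "(\<And>j. j < n \<Longrightarrow> x j = y j) \<Longrightarrow> i < n \<Longrightarrow> mean_step n E \<theta> x i = mean_step n E \<theta> y i"
  unfolding mean_step_def wlap_def by (simp cong: lap_cong)

lemma weighted_sum_affine:
  fixes A q :: real
  shows "(\<Sum>e\<in>F. p e * (A - q * f e)) = (\<Sum>e\<in>F. p e) * A - q * (\<Sum>e\<in>F. p e * f e)"
  by (simp add: sum_distrib_right sum_distrib_left sum_subtractf algebra_simps)

lemma sum_of_bool_mult: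
  fixes n :: nat
  assumes "a < n"
  shows "(\<Sum>i<n. of_bool (i = a) * f i) = (f a :: real)"
  using assms by (subst sum.remove[of _ a]) auto

section \<open>The Dirichlet form of a connected graph\<close>

locale gossip_graph =
  fixes n :: nat and E :: "nat set set"
  assumes n: "n \<ge> 2" and simple: "simple_graph n E" and connected: "connected_graph n E"
begin

lemma finite_E: "finite E"
  using simple by (rule simple_graph_finite)

lemma edge_cases:
  assumes "e \<in> E"
  obtains a b where "e = {a, b}" "a < n" "b < n" "a \<noteq> b"
  using assms simple unfolding simple_graph_def card_2_iff by (metis insert_subset lessThan_iff)

lemma edge_prob_pos:
  assumes "e \<in> E"
  shows "edge_prob n E e > 0"
proof -
  obtain a b where e: "e = {a, b}" "a < n" "b < n" "a \<noteq> b" using assms by (rule edge_cases)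
  have "node_degree E i > 0" if "i < n" for i
    using node_degree_pos[OF n simple connected that] .
  with e n show ?thesis by (simp add: edge_prob_def add_pos_pos)
qed

lemma lap_const: "e \<in> E \<Longrightarrow> i < n \<Longrightarrow> lap n e (\<lambda>_. c) i = 0"
  by (elim edge_cases) (simp add: lap_edge)

lemma sum_lap: "e \<in> E \<Longrightarrow> (\<Sum>i<n. lap n e x i) = 0"
  by (elim edge_cases)
    (simp add: lap_edge sum_distrib_right[symmetric] sum_subtractf of_bool_def sum.delta)

lemma sum_lap_mult:
  assumes "a < n" "b < n" "a \<noteq> b"
  shows "(\<Sum>i<n. x i * lap n {a, b} x i) = (x a - x b)\<^sup>2"
proof -
  have "(\<Sum>i<n. x i * lap n {a, b} x i) =
      (\<Sum>i<n. of_bool (i = a) * (x i * (x a - x b))) - (\<Sum>i<n. of_bool (i = b) * (x i * (x a - x b)))"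
    unfolding sum_subtractf[symmetric]
    by (intro sum.cong refl) (simp add: assms lap_edge algebra_simps)
  also have "\<dots> = x a * (x a - x b) - x b * (x a - x b)"
    by (simp only: sum_of_bool_mult assms)
  finally show ?thesis by (simp add: power2_eq_square algebra_simps)
qed

text \<open>An edge Laplacian is symmetric with \<open>L_e^2 = 2 L_e\<close>: its only nonzero
  eigenvalue is 2.\<close>

lemma sum_lap_square:
  assumes "e \<in> E"
  shows "(\<Sum>i<n. (lap n e x i)\<^sup>2) = 2 * (\<Sum>i<n. x i * lap n e x i)"
proof -
  obtain a b where e: "e = {a, b}" "a < n" "b < n" "a \<noteq> b" using assms by (rule edge_cases)
  have "(\<Sum>i<n. (lap n e x i)\<^sup>2) =
      (\<Sum>i<n. of_bool (i = a) * (x a - x b)\<^sup>2) + (\<Sum>i<n. of_bool (i = b) * (x a - x b)\<^sup>2)"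
    unfolding sum.distrib[symmetric]
    using e by (intro sum.cong refl) (auto simp: lap_edge power2_eq_square algebra_simps)
  then show ?thesis using e by (simp add: sum_of_bool_mult sum_lap_mult)
qed

lemma dirichlet_eq:
  "dirichlet n E x = (\<Sum>e\<in>E. edge_prob n E e * (\<Sum>i<n. x i * lap n e x i))"
  unfolding dirichlet_def wlap_def sum_distrib_left
  by (subst sum.swap) (simp add: mult_ac)

lemma energy_nonneg: "e \<in> E \<Longrightarrow> (\<Sum>i<n. x i * lap n e x i) \<ge> 0"
  by (elim edge_cases) (simp add: sum_lap_mult)

lemma dirichlet_nonneg: "dirichlet n E x \<ge> 0"
  unfolding dirichlet_eq by (intro sum_nonneg mult_nonneg_nonneg edge_prob_nonneg energy_nonneg)

lemma sum_wlap: "(\<Sum>i<n. wlap n E x i) = 0"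
  unfolding wlap_def by (subst sum.swap) (simp add: sum_distrib_left[symmetric] sum_lap)

lemma sum_mean_step: "(\<Sum>i<n. mean_step n E \<theta> x i) = (\<Sum>i<n. x i)"
  unfolding mean_step_def sum_subtractf sum_distrib_left[symmetric] sum_wlap by simp

lemma mean_step_const: "i < n \<Longrightarrow> mean_step n E \<theta> (\<lambda>_. c) i = c"
  unfolding mean_step_def wlap_def by (simp add: lap_const)

lemma mean_step_eq:
  "mean_step n E \<theta> x i = (\<Sum>e\<in>E. edge_prob n E e * (x i - \<theta> * lap n e x i))"
proof -
  have "(\<Sum>e\<in>E. edge_prob n E e * (x i - \<theta> * lap n e x i)) =
      (\<Sum>e\<in>E. edge_prob n E e) * x i - \<theta> * (\<Sum>e\<in>E. edge_prob n E e * lap n e x i)"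
    unfolding sum_distrib_left sum_distrib_right sum_subtractf[symmetric]
    by (intro sum.cong refl) (simp add: algebra_simps)
  then show ?thesis
    by (simp add: mean_step_def wlap_def sum_edge_prob[OF n simple connected])
qed

text \<open>By Jensen, the square of the average over edges is at most the average of the squares.
  For a single edge the square expands exactly, thanks to \<open>L_e^2 = 2 L_e\<close>. The loss
  vanishes at \<theta> = 1 and is half the Dirichlet form at \<theta> = 1/2.\<close>

lemma sum_mean_step_square_le:
  "(\<Sum>i<n. (mean_step n E \<theta> x i)\<^sup>2) \<le> (\<Sum>i<n. (x i)\<^sup>2) - 2 * \<theta> * (1 - \<theta>) * dirichlet n E x"
proof -
  let ?p = "edge_prob n E"
  have "(mean_step n E \<theta> x i)\<^sup>2 \<le> (\<Sum>e\<in>E. ?p e * (x i - \<theta> * lap n e x i)\<^sup>2)" for i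
  proof -
    have "E \<noteq> {}" using sum_edge_prob[OF n simple connected] by auto
    then show ?thesis
      unfolding mean_step_eq
      using convex_on_sum[of E UNIV "\<lambda>y::real. y\<^sup>2" ?p "\<lambda>e. x i - \<theta> * lap n e x i"]
      by (simp add: finite_E sum_edge_prob[OF n simple connected] edge_prob_nonneg convex_power2)
  qed
  then have "(\<Sum>i<n. (mean_step n E \<theta> x i)\<^sup>2) \<le> (\<Sum>i<n. \<Sum>e\<in>E. ?p e * (x i - \<theta> * lap n e x i)\<^sup>2)"
    by (rule sum_mono)
  also have "\<dots> = (\<Sum>e\<in>E. ?p e * (\<Sum>i<n. (x i - \<theta> * lap n e x i)\<^sup>2))"
    by (subst sum.swap) (simp add: sum_distrib_left)
  also have "\<dots> = (\<Sum>e\<in>E. ?p e * ((\<Sum>i<n. (x i)\<^sup>2) - 2 * \<theta> * (1 - \<theta>) * (\<Sum>i<n. x i * lap n e x i)))"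
  proof (intro sum.cong refl)
    fix e assume e: "e \<in> E"
    have "(\<Sum>i<n. (x i - \<theta> * lap n e x i)\<^sup>2) =
        (\<Sum>i<n. (x i)\<^sup>2 + (\<theta>\<^sup>2 * (lap n e x i)\<^sup>2 - 2 * \<theta> * (x i * lap n e x i)))"
      by (intro sum.cong refl) (simp add: power2_eq_square algebra_simps)
    also have "\<dots> = (\<Sum>i<n. (x i)\<^sup>2) + (\<theta>\<^sup>2 * (\<Sum>i<n. (lap n e x i)\<^sup>2) - 2 * \<theta> * (\<Sum>i<n. x i * lap n e x i))"
      by (simp only: sum.distrib sum_subtractf sum_distrib_left)
    also have "\<dots> = (\<Sum>i<n. (x i)\<^sup>2) - 2 * \<theta> * (1 - \<theta>) * (\<Sum>i<n. x i * lap n e x i)"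
      unfolding sum_lap_square[OF e] by (simp add: power2_eq_square algebra_simps)
    finally show "?p e * (\<Sum>i<n. (x i - \<theta> * lap n e x i)\<^sup>2) =
        ?p e * ((\<Sum>i<n. (x i)\<^sup>2) - 2 * \<theta> * (1 - \<theta>) * (\<Sum>i<n. x i * lap n e x i))"
      by simp
  qed
  also have "\<dots> = (\<Sum>e\<in>E. ?p e) * (\<Sum>i<n. (x i)\<^sup>2) - 2 * \<theta> * (1 - \<theta>) * dirichlet n E x"
    unfolding dirichlet_eq by (rule weighted_sum_affine)
  finally show ?thesis by (simp add: sum_edge_prob[OF n simple connected])
qed

text \<open>Differences add up along a path. An edge of probability \<open>p\<close> contributes
  \<open>1 / sqrt p\<close>, because \<open>p\<close> times its squared difference is one of the
  nonnegative terms of the Dirichlet form. The constant does not depend on \<open>x\<close>.\<close>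

lemma path_difference_bound:
  assumes "(i, j) \<in> {(u, v). {u, v} \<in> E}\<^sup>*"
  shows "\<exists>C\<ge>0. \<forall>x. \<bar>x i - x j\<bar> \<le> C * sqrt (dirichlet n E x)"
  using assms
proof induction
  case base
  show ?case by (intro exI[of _ 0]) simp
next
  case (step u v)
  then obtain C where C: "C \<ge> 0" "\<And>x. \<bar>x i - x u\<bar> \<le> C * sqrt (dirichlet n E x)" by blast
  define p where "p = edge_prob n E {u, v}"
  have uv: "{u, v} \<in> E" using step by simp
  have p: "p > 0" unfolding p_def using uv by (rule edge_prob_pos)
  have bound: "\<bar>x u - x v\<bar> \<le> (1 / sqrt p) * sqrt (dirichlet n E x)" for x
  proof -
    have uv': "u < n" "v < n" "u \<noteq> v"
      using edge_cases[OF uv] by (metis doubleton_eq_iff)+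
    have "p * (x u - x v)\<^sup>2 \<le> dirichlet n E x"
      unfolding dirichlet_eq p_def sum_lap_mult[OF uv', symmetric]
      by (rule member_le_sum[OF uv])
        (auto intro!: mult_nonneg_nonneg edge_prob_nonneg energy_nonneg simp: finite_E)
    then have "sqrt (p * (x u - x v)\<^sup>2) \<le> sqrt (dirichlet n E x)" by simp
    then show ?thesis using p by (simp add: real_sqrt_mult field_simps)
  qed
  have "\<bar>x i - x v\<bar> \<le> (C + 1 / sqrt p) * sqrt (dirichlet n E x)" for x
    using C(2)[of x] bound[of x] by (simp add: distrib_right)
  with C(1) p show ?case by (intro exI[of _ "C + 1 / sqrt p"]) simp
qed

text \<open>If the entries sum to zero, \<open>n * x i\<close> is the sum of the differences
  \<open>x i - x j\<close>, each of which is controlled along a path.\<close>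

lemma poincare_inequality:
  "\<exists>G\<ge>1. \<forall>x. (\<Sum>i<n. x i) = 0 \<longrightarrow> (\<Sum>i<n. (x i)\<^sup>2) \<le> G * dirichlet n E x"
proof -
  have "\<forall>i\<in>{..<n}. \<forall>j\<in>{..<n}. \<exists>C. C \<ge> 0 \<and> (\<forall>x. \<bar>x i - x j\<bar> \<le> C * sqrt (dirichlet n E x))"
    using path_difference_bound connected unfolding connected_graph_def by (metis lessThan_iff)
  then obtain C where C: "\<And>i j. i < n \<Longrightarrow> j < n \<Longrightarrow> C i j \<ge> 0"
    "\<And>i j x. i < n \<Longrightarrow> j < n \<Longrightarrow> \<bar>x i - x j\<bar> \<le> C i j * sqrt (dirichlet n E x)"
    by (metis lessThan_iff)
  define D where "D = (\<Sum>i<n. (\<Sum>j<n. C i j)\<^sup>2)"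
  have "(\<Sum>i<n. (x i)\<^sup>2) \<le> D * dirichlet n E x" if x: "(\<Sum>i<n. x i) = 0" for x
  proof -
    have "(x i)\<^sup>2 \<le> (\<Sum>j<n. C i j)\<^sup>2 * dirichlet n E x" if i: "i < n" for i
    proof -
      have "real n * x i = (\<Sum>j<n. x i - x j)" using x by (simp add: sum_subtractf)
      then have "real n * \<bar>x i\<bar> = \<bar>\<Sum>j<n. x i - x j\<bar>" by (metis abs_mult abs_of_nat)
      also have "\<dots> \<le> (\<Sum>j<n. \<bar>x i - x j\<bar>)" by (rule sum_abs)
      also have "\<dots> \<le> (\<Sum>j<n. C i j * sqrt (dirichlet n E x))"
        using C(2) i by (intro sum_mono) auto
      finally have *: "real n * \<bar>x i\<bar> \<le> (\<Sum>j<n. C i j) * sqrt (dirichlet n E x)"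
        by (simp add: sum_distrib_right)
      have "\<bar>x i\<bar> \<le> real n * \<bar>x i\<bar>"
        using n mult_right_mono[of 1 "real n" "\<bar>x i\<bar>"] by simp
      with * have "\<bar>x i\<bar> \<le> (\<Sum>j<n. C i j) * sqrt (dirichlet n E x)" by linarith
      then have "\<bar>x i\<bar>\<^sup>2 \<le> ((\<Sum>j<n. C i j) * sqrt (dirichlet n E x))\<^sup>2"
        by (rule power_mono) simp
      then show ?thesis by (simp add: power_mult_distrib dirichlet_nonneg)
    qed
    then have "(\<Sum>i<n. (x i)\<^sup>2) \<le> (\<Sum>i<n. (\<Sum>j<n. C i j)\<^sup>2 * dirichlet n E x)"
      by (intro sum_mono) simp
    then show ?thesis by (simp add: D_def sum_distrib_right)
  qed
  moreover have "D \<ge> 0" unfolding D_def by (simp add: sum_nonneg)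
  ultimately show ?thesis
    using dirichlet_nonneg
    \<comment> \<open>Adding 1 gives \<open>G \<ge> 1\<close>, which later places
      \<open>1 - 1 / (2 * G)\<close> between 1/2 and 1.\<close>
    by (intro exI[of _ "D + 1"]) (auto simp: distrib_right intro: add_increasing2)
qed

end

section \<open>Norm estimates\<close>

lemma L2_set_diff_le: "L2_set (\<lambda>i. x i - y i) A \<le> L2_set x A + L2_set y A"
proof -
  have "L2_set (\<lambda>i. x i + - y i) A \<le> L2_set x A + L2_set (\<lambda>i. - y i) A"
    by (rule L2_set_triangle_ineq)
  then show ?thesis by (simp add: L2_set_def)
qed

lemma L2_set_power2: "(L2_set x A)\<^sup>2 = (\<Sum>i\<in>A. (x i)\<^sup>2)"
  by (simp add: L2_set_def sum_nonneg)

text \<open>These are partial sums, with nonnegative terms, of the differentiated geometric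
  series.\<close>

lemma sum_power_mult_Suc_le:
  fixes \<rho> :: real
  assumes "0 \<le> \<rho>" "\<rho> < 1"
  shows "(\<Sum>m<t. real (Suc m) * \<rho> ^ m) \<le> 1 / (1 - \<rho>)\<^sup>2"
proof -
  have "(\<lambda>m. of_nat (Suc m) * \<rho> ^ m) sums (1 / (1 - \<rho>)\<^sup>2)"
    using assms by (intro geometric_deriv_sums) simp
  then show ?thesis
    using assms sum_le_suminf[of "\<lambda>m. of_nat (Suc m) * \<rho> ^ m" "{..<t}"]
    by (auto simp: sums_iff)
qed

text \<open>Unrolling bounds \<open>a t\<close> by a convolution of powers of \<rho> with
  \<open>D / (t - m)\<close>. After multiplication by \<open>t\<close>, the ratio
  \<open>t / (t - m)\<close> is at most \<open>m + 1\<close>, so the differentiated geometric series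
  bounds the sum uniformly in \<open>t\<close>.\<close>

lemma contracted_harmonic_recursion:
  fixes a :: "nat \<Rightarrow> real"
  assumes \<rho>: "0 \<le> \<rho>" "\<rho> < 1" and D: "D \<ge> 0" and "a 0 = 0"
    and rec: "\<And>t. a (Suc t) \<le> \<rho> * (a t + D / real (Suc t))"
    and t: "t \<ge> 1"
  shows "a t \<le> D / (1 - \<rho>)\<^sup>2 / real t"
proof -
  have a: "a t \<le> (\<Sum>m<t. \<rho> ^ Suc m * (D / real (t - m)))" for t
  proof (induction t)
    case (Suc t)
    have "a (Suc t) \<le> \<rho> * (a t + D / real (Suc t))" by (rule rec)
    also have "\<dots> \<le> \<rho> * ((\<Sum>m<t. \<rho> ^ Suc m * (D / real (t - m))) + D / real (Suc t))"
      using Suc.IH \<rho> by (intro mult_left_mono add_right_mono)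
    also have "\<dots> = (\<Sum>m<Suc t. \<rho> ^ Suc m * (D / real (Suc t - m)))"
      unfolding sum.lessThan_Suc_shift by (simp add: distrib_left sum_distrib_left mult_ac)
    finally show ?case .
  qed (simp add: \<open>a 0 = 0\<close>)
  have "real t * a t \<le> real t * (\<Sum>m<t. \<rho> ^ Suc m * (D / real (t - m)))"
    by (intro mult_left_mono a) simp
  also have "\<dots> \<le> (\<Sum>m<t. D * (real (Suc m) * \<rho> ^ m))"
    unfolding sum_distrib_left
  proof (intro sum_mono)
    fix m assume "m \<in> {..<t}"
    then have m: "m < t" by simp
    \<comment> \<open>\<open>(m + 1) * (t - m) = (t - m) + m * (t - m)\<close>, and the last term is
      at least \<open>m\<close> because \<open>t - m\<close> is at least 1.\<close>
    then have "m * 1 \<le> m * (t - m)" by (intro mult_le_mono2) simp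
    with m have "t \<le> Suc m * (t - m)" unfolding mult_Suc by linarith
    then have "real t \<le> real (Suc m) * real (t - m)"
      by (metis of_nat_le_iff of_nat_mult)
    then have *: "real t / real (t - m) \<le> real (Suc m)"
      using m by (simp add: divide_le_eq)
    have "real t * (\<rho> ^ Suc m * (D / real (t - m))) = \<rho> * (D * \<rho> ^ m * (real t / real (t - m)))"
      by simp
    also have "\<dots> \<le> 1 * (D * \<rho> ^ m * (real t / real (t - m)))"
      using \<rho> D by (intro mult_right_mono) auto
    also have "\<dots> \<le> 1 * (D * \<rho> ^ m * real (Suc m))"
      using \<rho> D * by (intro mult_left_mono) auto
    finally show "real t * (\<rho> ^ Suc m * (D / real (t - m))) \<le> D * (real (Suc m) * \<rho> ^ m)"
      by (simp add: mult_ac)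
  qed
  also have "\<dots> = D * (\<Sum>m<t. real (Suc m) * \<rho> ^ m)"
    by (simp add: sum_distrib_left)
  also have "\<dots> \<le> D * (1 / (1 - \<rho>)\<^sup>2)"
    using D by (intro mult_left_mono sum_power_mult_Suc_le \<rho>)
  finally have "a t * real t \<le> D / (1 - \<rho>)\<^sup>2" by (simp add: mult.commute)
  moreover have "real t > 0" using t by simp
  ultimately show ?thesis by (simp only: pos_le_divide_eq)
qed

section \<open>Euclidean bounds for the expected steps\<close>

context gossip_graph
begin

abbreviation nrm :: "(nat \<Rightarrow> real) \<Rightarrow> real" where
  "nrm x \<equiv> L2_set x {..<n}"

text \<open>The Dirichlet form is nonnegative, and where it vanishes the path bound makes all
  entries equal; so the kernel contains constant vectors only.\<close>

lemma second_smallest_eigenvalue_weighted_laplacian: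
  "second_smallest_eigenvalue (weighted_laplacian n E) \<noteq> 0"
proof (rule second_smallest_eigenvalue_nonzero[OF _ _ n])
  show L: "weighted_laplacian n E \<in> carrier_mat n n"
    by (simp add: weighted_laplacian_def)
  have entry: "edge_laplacian n e $$ (i, j) = edge_laplacian n e $$ (j, i)"
    if "e \<in> E" "i < n" "j < n" for e i j
    using edge_cases[OF that(1)] that(2,3) by (metis edge_laplacian_index mult.commute)
  show "transpose_mat (weighted_laplacian n E) = weighted_laplacian n E"
    by (intro eq_matI) (auto simp: weighted_laplacian_def entry intro!: sum.cong)
  have mult: "(weighted_laplacian n E *\<^sub>v v) $ i = wlap n E (\<lambda>j. v $ j) i"
    if "v \<in> carrier_vec n" "i < n" for v i
    using that unfolding wlap_def lap_def sum_distrib_left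
    by (subst sum.swap)
      (simp add: weighted_laplacian_def scalar_prod_def lessThan_atLeast0 sum_distrib_left mult_ac)
  show "v \<bullet> (weighted_laplacian n E *\<^sub>v v) \<ge> 0" if v: "v \<in> carrier_vec n" for v
  proof -
    have "v \<bullet> (weighted_laplacian n E *\<^sub>v v) = dirichlet n E (\<lambda>j. v $ j)"
      using mult[OF v] L by (simp add: scalar_prod_def dirichlet_def lessThan_atLeast0)
    then show ?thesis using dirichlet_nonneg by simp
  qed
  show "v $ i = v $ j"
    if v: "v \<in> carrier_vec n" "weighted_laplacian n E *\<^sub>v v = 0\<^sub>v n" and ij: "i < n" "j < n" for v i j
  proof -
    have "dirichlet n E (\<lambda>j. v $ j) = 0"
      unfolding dirichlet_def by (simp add: mult[OF v(1), symmetric] v(2))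
    moreover have "(i, j) \<in> {(u, v). {u, v} \<in> E}\<^sup>*"
      using connected ij by (simp add: connected_graph_def)
    ultimately obtain C where "\<bar>v $ i - v $ j\<bar> \<le> C * sqrt 0"
      using path_difference_bound[of i j] by metis
    then show ?thesis by simp
  qed
qed

lemma nrm_mean_step_le: "nrm (mean_step n E 1 x) \<le> nrm x"
  unfolding L2_set_def using sum_mean_step_square_le[of 1 x] by simp

lemma nrm_mean_step_funpow_le: "nrm ((mean_step n E 1 ^^ t) x) \<le> nrm x"
  by (induction t) (auto intro: order_trans nrm_mean_step_le)

lemma sum_mean_step_funpow: "(\<Sum>i<n. (mean_step n E \<theta> ^^ t) x i) = (\<Sum>i<n. x i)"
  by (induction t) (simp_all add: sum_mean_step)

lemma mean_step_funpow_diff_const: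
  "i < n \<Longrightarrow> (mean_step n E \<theta> ^^ t) (\<lambda>i. x i - c) i = (mean_step n E \<theta> ^^ t) x i - c"
proof (induction t arbitrary: i)
  case (Suc t)
  have "mean_step n E \<theta> ((mean_step n E \<theta> ^^ t) (\<lambda>i. x i - c)) i =
      mean_step n E \<theta> (\<lambda>i. (mean_step n E \<theta> ^^ t) x i - c) i"
    by (intro mean_step_cong Suc)
  then show ?case using Suc.prems by (simp add: mean_step_diff mean_step_const)
qed simp

text \<open>
  The partial sums \<open>S\<close> of the powers of the expected swapping operator \<open>I - L\<close> satisfy
  \<open>L S = h - (I - L)^t h\<close>, so the Poincare inequality bounds them uniformly in \<open>t\<close>; no spectral
  gap at the eigenvalue \<open>-1\<close> is needed.
\<close>

lemma nrm_partial_sums_le: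
  assumes G: "G \<ge> 1" "\<forall>x. (\<Sum>i<n. x i) = 0 \<longrightarrow> (\<Sum>i<n. (x i)\<^sup>2) \<le> G * dirichlet n E x"
    and h: "(\<Sum>i<n. h i) = 0"
  shows "nrm (\<lambda>i. \<Sum>s<t. (mean_step n E 1 ^^ s) h i) \<le> 2 * G * nrm h"
proof -
  define S where "S = (\<lambda>i. \<Sum>s<t. (mean_step n E 1 ^^ s) h i)"
  have "wlap n E S = (\<lambda>i. h i - (mean_step n E 1 ^^ t) h i)"
  proof
    fix i
    have "wlap n E S i = (\<Sum>s<t. wlap n E ((mean_step n E 1 ^^ s) h) i)"
      unfolding S_def by (rule wlap_sum)
    also have "\<dots> = (\<Sum>s<t. (mean_step n E 1 ^^ s) h i - (mean_step n E 1 ^^ Suc s) h i)"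
      by (simp add: mean_step_def)
    also have "\<dots> = h i - (mean_step n E 1 ^^ t) h i"
      by (subst sum_lessThan_telescope') simp
    finally show "wlap n E S i = h i - (mean_step n E 1 ^^ t) h i" .
  qed
  then have "nrm (wlap n E S) \<le> nrm h + nrm ((mean_step n E 1 ^^ t) h)"
    by (simp add: L2_set_diff_le)
  then have LS: "nrm (wlap n E S) \<le> 2 * nrm h"
    using nrm_mean_step_funpow_le[of t h] by linarith
  have "(\<Sum>i<n. S i) = (\<Sum>s<t. \<Sum>i<n. (mean_step n E 1 ^^ s) h i)"
    unfolding S_def by (rule sum.swap)
  also have "\<dots> = 0" by (simp add: sum_mean_step_funpow h)
  \<comment> \<open>The Poincare inequality and Cauchy-Schwarz bound the square of
    \<open>nrm S\<close> by \<open>G * nrm S * nrm (wlap n E S)\<close>; one factor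
    \<open>nrm S\<close> then cancels.\<close>
  finally have "(nrm S)\<^sup>2 \<le> G * dirichlet n E S"
    unfolding L2_set_power2 by (rule G(2)[rule_format])
  also have "dirichlet n E S \<le> (\<Sum>i<n. \<bar>S i\<bar> * \<bar>wlap n E S i\<bar>)"
    unfolding dirichlet_def by (intro sum_mono) (metis abs_ge_self abs_mult)
  also have "\<dots> \<le> nrm S * nrm (wlap n E S)" by (rule L2_set_mult_ineq)
  also have "\<dots> \<le> nrm S * (2 * nrm h)" by (intro mult_left_mono LS) simp
  finally have "nrm S * nrm S \<le> nrm S * (2 * G * nrm h)"
    using G(1) by (simp add: power2_eq_square mult_ac)
  then have "nrm S \<le> 2 * G * nrm h"
    using G(1) L2_set_nonneg[of S "{..<n}"]
    by (cases "nrm S = 0") (simp_all add: mult_le_cancel_left)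
  then show ?thesis by (simp only: S_def)
qed

text \<open>An averaging step removes at least half the Dirichlet form from the squared norm, and
  that form is at least the squared norm divided by \<open>G\<close>.\<close>

lemma nrm_averaging_step_le:
  assumes G: "G \<ge> 1" "\<forall>x. (\<Sum>i<n. x i) = 0 \<longrightarrow> (\<Sum>i<n. (x i)\<^sup>2) \<le> G * dirichlet n E x"
    and x: "(\<Sum>i<n. x i) = 0"
  shows "nrm (mean_step n E (1 / 2) x) \<le> sqrt (1 - 1 / (2 * G)) * nrm x"
proof -
  have "(\<Sum>i<n. (x i)\<^sup>2) / G \<le> dirichlet n E x"
    using G(2)[rule_format, OF x] G(1) by (simp add: field_simps)
  then have "(\<Sum>i<n. (mean_step n E (1 / 2) x i)\<^sup>2) \<le> (1 - 1 / (2 * G)) * (\<Sum>i<n. (x i)\<^sup>2)"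
    using sum_mean_step_square_le[of "1 / 2" x] by (simp add: left_diff_distrib)
  then show ?thesis
    unfolding L2_set_def real_sqrt_mult[symmetric] by simp
qed

text \<open>By Cauchy-Schwarz the constant vector of the mean is no longer than \<open>x\<close>;
  the triangle inequality gives the factor 2.\<close>

lemma nrm_center_le: "nrm (\<lambda>i. x i - (\<Sum>j<n. x j) / real n) \<le> 2 * nrm x"
proof -
  define m where "m = (\<Sum>j<n. x j) / real n"
  have "\<bar>\<Sum>j<n. x j\<bar> \<le> (\<Sum>j<n. \<bar>x j\<bar> * \<bar>1\<bar>)" by simp
  also have "\<dots> \<le> nrm x * nrm (\<lambda>_. 1)" by (rule L2_set_mult_ineq)
  also have "\<dots> = nrm x * sqrt (real n)" by (simp add: L2_set_constant)
  finally have *: "\<bar>\<Sum>j<n. x j\<bar> \<le> nrm x * sqrt (real n)" .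
  have "\<bar>m\<bar> * sqrt (real n) * sqrt (real n) = \<bar>m\<bar> * real n" by simp
  also have "\<dots> = \<bar>\<Sum>j<n. x j\<bar>" using n by (simp add: m_def)
  finally have "\<bar>m\<bar> * sqrt (real n) * sqrt (real n) \<le> nrm x * sqrt (real n)" using * by simp
  then have "\<bar>m\<bar> * sqrt (real n) \<le> nrm x"
    using n by (simp only: mult_le_cancel_right) simp
  then have "nrm (\<lambda>_. m) \<le> nrm x" by (simp add: L2_set_constant mult.commute)
  then show ?thesis
    using L2_set_diff_le[of x "\<lambda>_. m" "{..<n}"] by (simp add: m_def)
qed

text \<open>The expected step fixes constants and preserves sums, so it commutes with centering. The
  centered recursion is therefore a contraction with input at most \<open>2 * D / t\<close>, the 2
  coming from \<open>nrm_center_le\<close>.\<close>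

lemma averaging_recursion_bound:
  assumes G: "G \<ge> 1" "\<forall>x. (\<Sum>i<n. x i) = 0 \<longrightarrow> (\<Sum>i<n. (x i)\<^sup>2) \<le> G * dirichlet n E x"
    and D: "\<And>t. nrm (d (Suc t)) \<le> D / real (Suc t)"
    and z0: "\<And>i. i < n \<Longrightarrow> z 0 i = 0"
    and z: "\<And>t i. i < n \<Longrightarrow> z (Suc t) i = mean_step n E (1 / 2) (\<lambda>j. z t j + d (Suc t) j) i"
    and t: "t \<ge> 1"
  shows "nrm (\<lambda>i. z t i - (\<Sum>j<n. z t j) / real n) \<le>
    2 * D / (1 - sqrt (1 - 1 / (2 * G)))\<^sup>2 / real t"
proof -
  define c where "c x = (\<lambda>i. x i - (\<Sum>j<n. x j) / real n)" for x :: "nat \<Rightarrow> real"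
  define \<rho> where "\<rho> = sqrt (1 - 1 / (2 * G))"
  have \<rho>: "0 \<le> \<rho>" "\<rho> < 1" using G(1) by (simp_all add: \<rho>_def)
  have D0: "D \<ge> 0" using order_trans[OF L2_set_nonneg D[of 0]] by simp
  have sum_c: "(\<Sum>i<n. c x i) = 0" for x using n by (simp add: c_def sum_subtractf)
  have rec: "nrm (c (z (Suc t))) \<le> \<rho> * (nrm (c (z t)) + 2 * D / real (Suc t))" for t
  proof -
    define y where "y = (\<lambda>j. z t j + d (Suc t) j)"
    have "c (z (Suc t)) i = mean_step n E (1 / 2) (c y) i" if "i < n" for i
      using that z by (simp add: c_def y_def[symmetric] mean_step_diff mean_step_const sum_mean_step)
    then have "nrm (c (z (Suc t))) = nrm (mean_step n E (1 / 2) (c y))"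
      by (intro L2_set_cong) auto
    also have "\<dots> \<le> \<rho> * nrm (c y)"
      unfolding \<rho>_def by (intro nrm_averaging_step_le G sum_c)
    also have "c y = (\<lambda>i. c (z t) i + c (d (Suc t)) i)"
      by (rule ext) (simp add: c_def y_def sum.distrib add_divide_distrib)
    also have "nrm (\<lambda>i. c (z t) i + c (d (Suc t)) i) \<le> nrm (c (z t)) + nrm (c (d (Suc t)))"
      by (rule L2_set_triangle_ineq)
    also have "nrm (c (d (Suc t))) \<le> 2 * nrm (d (Suc t))"
      unfolding c_def by (rule nrm_center_le)
    also have "\<dots> \<le> 2 * (D / real (Suc t))" by (intro mult_left_mono D) simp
    finally show ?thesis using \<rho> by (simp add: mult_left_mono)
  qed
  have "nrm (c (z 0)) = 0" by (simp add: c_def z0 L2_set_0')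
  from contracted_harmonic_recursion[where a = "\<lambda>t. nrm (c (z t))", OF \<rho> _ this rec t] D0
  show ?thesis by (simp add: c_def \<rho>_def)
qed

end

section \<open>Independence of the next edge\<close>

text \<open>Dependence on the first \<open>t\<close> coordinates only. Invariance under restriction
  allows the same function to be read on the finite product over 1 to \<open>t\<close> and on the
  infinite product.\<close>

definition adapted :: "(nat \<Rightarrow> 'a measure) \<Rightarrow> nat \<Rightarrow> ((nat \<Rightarrow> 'a) \<Rightarrow> real) \<Rightarrow> bool" where
  "adapted M t B \<longleftrightarrow> B \<in> borel_measurable (PiM {0<..t} M) \<and> (\<forall>e. B (restrict e {0<..t}) = B e)"

lemma adapted_const [intro]: "adapted M t (\<lambda>_. c)"
  by (auto simp: adapted_def)

lemma adapted_add [intro]: "adapted M t B \<Longrightarrow> adapted M t C \<Longrightarrow> adapted M t (\<lambda>e. B e + C e)"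
  by (auto simp: adapted_def)

lemma adapted_diff [intro]: "adapted M t B \<Longrightarrow> adapted M t C \<Longrightarrow> adapted M t (\<lambda>e. B e - C e)"
  by (auto simp: adapted_def)

lemma adapted_mult [intro]: "adapted M t B \<Longrightarrow> adapted M t C \<Longrightarrow> adapted M t (\<lambda>e. B e * C e)"
  by (auto simp: adapted_def)

lemma adapted_sum [intro]:
  "(\<And>i. i \<in> I \<Longrightarrow> adapted M t (B i)) \<Longrightarrow> adapted M t (\<lambda>e. \<Sum>i\<in>I. B i e)"
  by (auto simp: adapted_def intro!: borel_measurable_sum)

lemma adapted_of_bool_less [intro]:
  assumes "adapted M t B"
  shows "adapted M t (\<lambda>e. of_bool (B e < c))"
proof -
  have [measurable]: "B \<in> borel_measurable (PiM {0<..t} M)" using assms by (simp add: adapted_def)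
  have "(\<lambda>e. of_bool (B e < c) :: real) = (\<lambda>e. if B e < c then 1 else 0)" by auto
  then have "(\<lambda>e. of_bool (B e < c) :: real) \<in> borel_measurable (PiM {0<..t} M)" by simp
  with assms show ?thesis by (simp add: adapted_def)
qed

lemma adapted_coordinate:
  assumes "s \<in> {0<..t}" "A \<in> borel_measurable (M s)"
  shows "adapted M t (\<lambda>e. A (e s))"
  unfolding adapted_def
  using assms measurable_compose[OF measurable_component_singleton[OF assms(1), of M] assms(2)]
  by simp

lemma adapted_mono:
  assumes "adapted M t B" "t \<le> t'"
  shows "adapted M t' B"
proof -
  have B: "B = (\<lambda>e. B (restrict e {0<..t}))" using assms(1) by (simp add: adapted_def)
  have "(\<lambda>e. B (restrict e {0<..t})) \<in> borel_measurable (PiM {0<..t'} M)"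
    using assms by (intro measurable_compose[OF measurable_restrict_subset]) (auto simp: adapted_def)
  then have "B \<in> borel_measurable (PiM {0<..t'} M)" using B by simp
  moreover have "B (restrict e {0<..t'}) = B e" for e
  proof -
    have "restrict (restrict e {0<..t'}) {0<..t} = restrict e {0<..t}"
      using assms(2) by (auto simp: restrict_def)
    then show ?thesis using B by metis
  qed
  ultimately show ?thesis by (simp add: adapted_def)
qed

lemma adapted_borel_measurable:
  assumes "adapted M t B"
  shows "B \<in> borel_measurable (PiM {1..} M)"
proof -
  have "(\<lambda>e. B (restrict e {0<..t})) \<in> borel_measurable (PiM {1..} M)"
    using assms by (intro measurable_compose[OF measurable_restrict_subset]) (auto simp: adapted_def)
  with assms show ?thesis by (simp add: adapted_def)
qed

text \<open>The joint law of the coordinates is the product measure itself, which is also the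
  product of the marginal laws.\<close>

lemma (in product_prob_space) indep_vars_coordinates:
  assumes "I \<noteq> {}"
  shows "prob_space.indep_vars (PiM I M) M (\<lambda>i \<omega>. \<omega> i) I"
proof -
  interpret P: prob_space "PiM I M" by (rule prob_space_PiM) (rule prob_space)
  have "distr (PiM I M) (PiM I M) (\<lambda>x. \<lambda>i\<in>I. x i) = distr (PiM I M) (PiM I M) (\<lambda>x. x)"
    by (intro distr_cong) (auto simp: space_PiM PiE_restrict)
  also have "\<dots> = PiM I M" by (rule distr_id)
  also have "\<dots> = (\<Pi>\<^sub>M i\<in>I. distr (PiM I M) (M i) (\<lambda>\<omega>. \<omega> i))"
    by (intro PiM_cong refl) (simp add: PiM_component)
  finally show ?thesis
    using assms by (subst P.indep_vars_iff_distr_eq_PiM') auto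
qed

text \<open>The two variables factor through restrictions to the disjoint index sets
  \<open>{Suc t}\<close> and \<open>{0<..t}\<close>.\<close>

lemma indep_next_step:
  assumes M: "\<And>i. prob_space (M i)"
    and B: "adapted M t B" and A: "A \<in> borel_measurable (M (Suc t))"
  shows "prob_space.indep_var (PiM {1..} M) borel (\<lambda>e. A (e (Suc t))) borel B"
proof -
  interpret product_prob_space M "{1..}"
    using M by (simp add: product_prob_space_def product_prob_space_axioms_def
        product_sigma_finite_def prob_space_imp_sigma_finite)
  interpret P: prob_space "PiM {1..} M" by (rule prob_space_PiM) (rule M)
  have "P.indep_var (PiM {Suc t} M) (\<lambda>\<omega>. restrict (\<lambda>i. \<omega> i) {Suc t})
      (PiM {0<..t} M) (\<lambda>\<omega>. restrict (\<lambda>i. \<omega> i) {0<..t})"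
    by (rule P.indep_var_restrict[OF indep_vars_coordinates]) auto
  then have "P.indep_var borel ((\<lambda>e. A (e (Suc t))) \<circ> (\<lambda>\<omega>. restrict (\<lambda>i. \<omega> i) {Suc t}))
      borel (B \<circ> (\<lambda>\<omega>. restrict (\<lambda>i. \<omega> i) {0<..t}))"
    by (rule P.indep_var_compose)
      (use A B in \<open>auto simp: adapted_def intro: measurable_compose[OF measurable_component_singleton]\<close>)
  then show ?thesis using B by (simp add: o_def adapted_def)
qed

section \<open>The random edge sequence\<close>

context gossip_graph
begin

abbreviation \<Omega> :: "(nat \<Rightarrow> nat set) measure" where
  "\<Omega> \<equiv> edge_sequences n E"

abbreviation step_adapted :: "nat \<Rightarrow> ((nat \<Rightarrow> nat set) \<Rightarrow> real) \<Rightarrow> bool" where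
  "step_adapted \<equiv> adapted (\<lambda>_. measure_pmf (edge_pmf n E))"

lemma prob_space_edge_sequences: "prob_space \<Omega>"
  unfolding edge_sequences_def by (rule prob_space_PiM) (rule prob_space_measure_pmf)

lemma set_pmf_edge_pmf: "set_pmf (edge_pmf n E) \<subseteq> E"
  by (auto simp: set_pmf_iff pmf_edge_pmf[OF n simple connected] split: if_splits)

lemma distr_edge:
  assumes "s \<ge> 1"
  shows "distr \<Omega> (measure_pmf (edge_pmf n E)) (\<lambda>e. e s) = measure_pmf (edge_pmf n E)"
proof -
  interpret product_prob_space "\<lambda>_. measure_pmf (edge_pmf n E)" "{1..}"
    by (simp add: product_prob_space_def product_prob_space_axioms_def
        product_sigma_finite_def prob_space_imp_sigma_finite prob_space_measure_pmf)
  show ?thesis unfolding edge_sequences_def using PiM_component[of s] assms by simp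
qed

lemma measurable_edge:
  "s \<ge> 1 \<Longrightarrow> (\<lambda>e. e s) \<in> measurable \<Omega> (measure_pmf (edge_pmf n E))"
  unfolding edge_sequences_def by (rule measurable_component_singleton) simp

lemma integrable_edge:
  fixes A :: "nat set \<Rightarrow> real"
  assumes "s \<ge> 1"
  shows "integrable \<Omega> (\<lambda>e. A (e s))"
proof -
  have "finite (set_pmf (edge_pmf n E))"
    using set_pmf_edge_pmf finite_E by (rule finite_subset)
  then have "integrable (measure_pmf (edge_pmf n E)) A" by (rule integrable_measure_pmf_finite)
  then have "integrable (distr \<Omega> (measure_pmf (edge_pmf n E)) (\<lambda>e. e s)) A"
    by (simp only: distr_edge[OF assms])
  then show ?thesis
    by (subst (asm) integrable_distr_eq[OF measurable_edge[OF assms]]) auto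
qed

lemma integral_edge:
  fixes A :: "nat set \<Rightarrow> real"
  assumes "s \<ge> 1"
  shows "(\<integral>e. A (e s) \<partial>\<Omega>) = (\<Sum>e\<in>E. edge_prob n E e * A e)"
proof -
  have "(\<integral>e. A (e s) \<partial>\<Omega>) = (\<integral>e. A e \<partial>measure_pmf (edge_pmf n E))"
    using integral_distr[OF measurable_edge[OF assms], of A] by (simp add: distr_edge[OF assms])
  also have "\<dots> = (\<Sum>e\<in>E. A e * pmf (edge_pmf n E) e)"
    using set_pmf_edge_pmf finite_E by (intro integral_measure_pmf_real) auto
  finally show ?thesis
    by (simp add: pmf_edge_pmf[OF n simple connected] mult.commute)
qed

text \<open>A realisation is an arbitrary sequence of sets, so the fact that swaps permute entries
  is available only almost surely.\<close>

lemma AE_edges: "AE e in \<Omega>. \<forall>s\<ge>1. e s \<in> E"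
proof -
  have "AE e in \<Omega>. e s \<in> E" if "s \<ge> 1" for s
  proof -
    have "AE x in measure_pmf (edge_pmf n E). x \<in> E"
      using set_pmf_edge_pmf by (auto simp: AE_measure_pmf_iff)
    then have "AE x in distr \<Omega> (measure_pmf (edge_pmf n E)) (\<lambda>e. e s). x \<in> E"
      unfolding distr_edge[OF that] .
    then show ?thesis by (subst (asm) AE_distr_iff[OF measurable_edge[OF that]]) auto
  qed
  then show ?thesis by (simp add: AE_all_countable)
qed

text \<open>The edge drawn at step \<open>t + 1\<close> is independent of everything determined by
  the first \<open>t\<close> edges, so the expectation factors.\<close>

lemma
  fixes A :: "nat set \<Rightarrow> real"
  assumes B: "step_adapted t B" and int: "integrable \<Omega> B"
  shows integrable_next_step_mult: "integrable \<Omega> (\<lambda>e. A (e (Suc t)) * B e)"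
    and integral_next_step_mult:
      "(\<integral>e. A (e (Suc t)) * B e \<partial>\<Omega>) = (\<Sum>e\<in>E. edge_prob n E e * A e) * (\<integral>e. B e \<partial>\<Omega>)"
proof -
  interpret prob_space \<Omega> by (rule prob_space_edge_sequences)
  have "indep_var borel (\<lambda>e. A (e (Suc t))) borel B"
    unfolding edge_sequences_def
    by (rule indep_next_step[OF _ B]) (simp_all add: prob_space_measure_pmf)
  moreover have "integrable \<Omega> (\<lambda>e. A (e (Suc t)))" by (rule integrable_edge) simp
  ultimately show "integrable \<Omega> (\<lambda>e. A (e (Suc t)) * B e)"
    "(\<integral>e. A (e (Suc t)) * B e \<partial>\<Omega>) = (\<Sum>e\<in>E. edge_prob n E e * A e) * (\<integral>e. B e \<partial>\<Omega>)"
    using int by (simp_all add: indep_var_integrable indep_var_lebesgue_integral integral_edge)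
qed

end

section \<open>Expectations of one gossip step\<close>

lemma edge_laplacian_carrier: "edge_laplacian n e \<in> carrier_mat n n"
  unfolding edge_laplacian_def Let_def by (rule mult_carrier_mat) auto

lemma swapping_matrix_carrier: "swapping_matrix n e \<in> carrier_mat n n"
  unfolding swapping_matrix_def by (intro minus_carrier_mat edge_laplacian_carrier)

lemma averaging_matrix_carrier: "averaging_matrix n e \<in> carrier_mat n n"
  unfolding averaging_matrix_def
  by (intro minus_carrier_mat smult_carrier_mat edge_laplacian_carrier)

lemma dim_swapped_obs [simp]: "dim_vec (swapped_obs n X e s) = n"
  using swapping_matrix_carrier[of n] by (cases s) auto

lemma swapped_obs_Suc_index:
  "i < n \<Longrightarrow> swapped_obs n X e (Suc s) $ i =
    (\<Sum>j<n. swapping_matrix n (e (Suc s)) $$ (i, j) * swapped_obs n X e s $ j)"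
  using swapping_matrix_carrier[of n "e (Suc s)"]
  by (simp add: scalar_prod_def lessThan_atLeast0)

lemma gossip_estimate_Suc_index:
  "i < n \<Longrightarrow> gossip_estimate n f g X e (Suc t) $ i =
    (\<Sum>j<n. averaging_matrix n (e (Suc t)) $$ (i, j) *
      (gossip_estimate n f g X e t $ j + gossip_increment n f X e j (Suc t) * g (X j)))"
  using averaging_matrix_carrier[of n "e (Suc t)"]
  by (simp add: scalar_prod_def lessThan_atLeast0)

lemma adapted_swapped_obs:
  assumes "\<And>s (A :: nat set \<Rightarrow> real). A \<in> borel_measurable (M s)" "k < n"
  shows "adapted M s (\<lambda>e. swapped_obs n X e s $ k)"
  using assms(2)
proof (induction s arbitrary: k)
  case (Suc s)
  have "adapted M (Suc s) (\<lambda>e. \<Sum>j<n. swapping_matrix n (e (Suc s)) $$ (k, j) * swapped_obs n X e s $ j)"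
    by (intro adapted_sum adapted_mult adapted_coordinate adapted_mono[OF Suc.IH]) (auto simp: assms(1))
  then show ?case unfolding swapped_obs_Suc_index[OF Suc.prems] .
qed (auto simp: adapted_def)

text \<open>The estimate at time \<open>t\<close> compares with the observations held at times 0 to
  \<open>t - 1\<close>, hence reads only \<open>t - 1\<close> edges; this explains the bound
  \<open>Suc u\<close>.\<close>

lemma adapted_rank_estimate:
  assumes "\<And>s (A :: nat set \<Rightarrow> real). A \<in> borel_measurable (M s)" "k < n" "t \<le> Suc u"
  shows "adapted M u (\<lambda>e. rank_estimate n X e k t)"
  unfolding rank_estimate_def
  by (intro adapted_add adapted_mult adapted_const adapted_sum adapted_of_bool_less
      adapted_mono[OF adapted_swapped_obs[OF assms(1,2)]]) (use assms(3) in auto)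

text \<open>The increment at step \<open>t + 1\<close> is already determined by \<open>t\<close>
  edges. It is therefore independent of the edge averaged over at that step, even though the same
  edge also drives the swap.\<close>

lemma adapted_gossip_increment:
  assumes "\<And>s (A :: nat set \<Rightarrow> real). A \<in> borel_measurable (M s)" "k < n"
  shows "adapted M t (\<lambda>e. gossip_increment n (\<lambda>x. x) X e k (Suc t))"
  unfolding gossip_increment_def gossip_weight_def
  \<comment> \<open>At \<open>t = 0\<close> the previous weight is 0 by convention, not
    \<open>n\<close> times a rank estimate.\<close>
  by (cases "t = 0")
    (simp_all, (intro adapted_diff adapted_mult adapted_const adapted_rank_estimate assms; simp)+)

lemma adapted_gossip_estimate:
  assumes "\<And>s (A :: nat set \<Rightarrow> real). A \<in> borel_measurable (M s)" "k < n"
  shows "adapted M t (\<lambda>e. gossip_estimate n (\<lambda>x. x) g X e t $ k)"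
  using assms(2)
proof (induction t arbitrary: k)
  case (Suc t)
  have "adapted M (Suc t) (\<lambda>e. \<Sum>j<n. averaging_matrix n (e (Suc t)) $$ (k, j) *
      (gossip_estimate n (\<lambda>x. x) g X e t $ j + gossip_increment n (\<lambda>x. x) X e j (Suc t) * g (X j)))"
    by (intro adapted_sum adapted_mult adapted_add adapted_const adapted_coordinate
        adapted_mono[OF Suc.IH] adapted_mono[OF adapted_gossip_increment[OF assms(1)]])
      (auto simp: assms(1))
  then show ?case unfolding gossip_estimate_Suc_index[OF Suc.prems] .
qed (auto simp: adapted_def)

text \<open>A swap permutes the entries, so it commutes with applying a function entrywise.\<close>

lemma swapped_obs_map:
  assumes "\<And>s. s \<ge> 1 \<Longrightarrow> e s \<subseteq> {..<n} \<and> card (e s) = 2" "k < n"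
  shows "swapped_obs n (\<lambda>i. h (X i)) e s $ k = h (swapped_obs n X e s $ k)"
  using assms(2)
proof (induction s arbitrary: k)
  case (Suc s)
  obtain a b where ab: "e (Suc s) = {a, b}" "a < n" "b < n" "a \<noteq> b"
    using assms(1)[of "Suc s"] unfolding card_2_iff by auto
  have swap: "swapped_obs n Y e (Suc s) $ k =
      swapped_obs n Y e s $ (if k = a then b else if k = b then a else k)" for Y
  proof -
    define y where "y = (\<lambda>j. swapped_obs n Y e s $ j)"
    have "swapped_obs n Y e (Suc s) $ k =
        (\<Sum>j<n. of_bool (j = k) * y j - edge_laplacian n {a, b} $$ (k, j) * y j)"
      unfolding swapped_obs_Suc_index[OF Suc.prems] ab(1) y_def using Suc.prems
      by (intro sum.cong refl)
        (auto simp: swapping_matrix_def edge_laplacian_def Let_def algebra_simps)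
    also have "\<dots> = y k - lap n {a, b} y k"
      using Suc.prems by (simp add: sum_subtractf lap_def sum_of_bool_mult)
    also have "\<dots> = y (if k = a then b else if k = b then a else k)"
      using ab Suc.prems by (simp add: lap_edge)
    finally show ?thesis unfolding y_def .
  qed
  show ?case unfolding swap using ab Suc by simp
qed simp

text \<open>The estimate is affine in a running mean \<open>a\<close> of values in [0, 1]. A new
  value \<open>c\<close> moves the mean by \<open>(c - a) / (t + 1)\<close>.\<close>

lemma rank_estimate_Suc_diff_le:
  assumes "t \<ge> 1"
  shows "\<bar>rank_estimate n X e k (Suc t) - rank_estimate n X e k t\<bar> \<le> real n / real (Suc t)"
proof -
  define c where "c s = (of_bool (X k > swapped_obs n X e (s - 1) $ k) :: real)" for s
  define a where "a = (\<Sum>s=1..t. c s) / real t"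
  have rank: "rank_estimate n X e k u = 1 + real n / real u * (\<Sum>s=1..u. c s)" for u
    by (simp only: rank_estimate_def c_def)
  have c: "0 \<le> c s" "c s \<le> 1" for s by (simp_all add: c_def)
  have "(\<Sum>s=1..t. c s) \<le> real t"
    using sum_mono[of "{1..t}" c "\<lambda>_. 1"] c by simp
  then have a: "0 \<le> a" "a \<le> 1" using assms c by (simp_all add: a_def sum_nonneg)
  have "rank_estimate n X e k (Suc t) - rank_estimate n X e k t =
      real n * ((real t * a + c (Suc t)) / real (Suc t) - a)"
    using assms by (simp add: rank a_def right_diff_distrib)
  also have "(real t * a + c (Suc t)) / real (Suc t) - a = (c (Suc t) - a) / real (Suc t)"
    by (simp add: field_simps)
  finally have "\<bar>rank_estimate n X e k (Suc t) - rank_estimate n X e k t\<bar> =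
      real n * (\<bar>c (Suc t) - a\<bar> / real (Suc t))"
    by (simp add: abs_mult)
  also have "\<dots> \<le> real n * (1 / real (Suc t))"
    using a c[of "Suc t"] by (intro mult_left_mono divide_right_mono) auto
  finally show ?thesis by simp
qed

lemma rank_estimate_nonneg_le:
  assumes "t \<ge> 1"
  shows "0 \<le> rank_estimate n X e k t" "rank_estimate n X e k t \<le> 1 + real n"
proof -
  have "(\<Sum>s=1..t. of_bool (X k > swapped_obs n X e (s - 1) $ k)) \<le> (\<Sum>s=1..t. 1 :: real)"
    by (intro sum_mono) simp
  then have "real n / real t * (\<Sum>s=1..t. of_bool (X k > swapped_obs n X e (s - 1) $ k)) \<le>
      real n / real t * real t"
    by (intro mult_left_mono) simp_all
  then show "rank_estimate n X e k t \<le> 1 + real n"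
    using assms by (simp add: rank_estimate_def)
qed (simp add: rank_estimate_def sum_nonneg)

text \<open>The first increment is the whole first weight, at most \<open>n * (1 + n)\<close>; later
  ones are changes of a running mean. The constant covers both cases.\<close>

lemma gossip_increment_abs_le:
  "\<bar>gossip_increment n (\<lambda>x. x) X e k (Suc t)\<bar> \<le> real n * (1 + real n) / real (Suc t)"
proof (cases "t = 0")
  case True
  then show ?thesis
    using rank_estimate_nonneg_le[of 1 n X e k]
    by (simp add: gossip_increment_def gossip_weight_def abs_mult mult_left_mono)
next
  case False
  then have "\<bar>gossip_increment n (\<lambda>x. x) X e k (Suc t)\<bar> =
      real n * \<bar>rank_estimate n X e k (Suc t) - rank_estimate n X e k t\<bar>"
    by (simp add: gossip_increment_def gossip_weight_def right_diff_distrib[symmetric] abs_mult)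
  also have "\<dots> \<le> real n * (real n / real (Suc t))"
    using False by (intro mult_left_mono rank_estimate_Suc_diff_le) auto
  also have "\<dots> \<le> real n * ((1 + real n) / real (Suc t))"
    by (intro mult_left_mono divide_right_mono) auto
  finally show ?thesis by simp
qed

section \<open>Expectation of a random matrix applied to past data\<close>

context gossip_graph
begin

lemma integrable_bounded:
  assumes "step_adapted t B" "\<And>e. \<bar>B e\<bar> \<le> (c :: real)"
  shows "integrable \<Omega> B"
proof -
  interpret prob_space \<Omega> by (rule prob_space_edge_sequences)
  have "B \<in> borel_measurable \<Omega>"
    unfolding edge_sequences_def using assms(1) by (rule adapted_borel_measurable)
  then show ?thesis
    using assms(2) by (intro integrable_const_bound[of _ c]) auto
qed

text \<open>The matrix depends on edge \<open>t + 1\<close> and the vector on earlier edges, so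
  expectations factor entry by entry. The parameter \<theta> covers swapping and averaging at
  once.\<close>

lemma expected_matrix_mult:
  assumes "i < n"
    and A: "\<And>e j. e \<in> E \<Longrightarrow> j < n \<Longrightarrow> A e $$ (i, j) = of_bool (j = i) - \<theta> * edge_laplacian n e $$ (i, j)"
    and B: "\<And>j. j < n \<Longrightarrow> step_adapted t (\<lambda>e. B e j)" "\<And>j. j < n \<Longrightarrow> integrable \<Omega> (\<lambda>e. B e j)"
  shows "integrable \<Omega> (\<lambda>e. \<Sum>j<n. A (e (Suc t)) $$ (i, j) * B e j)"
    and "(\<integral>e. (\<Sum>j<n. A (e (Suc t)) $$ (i, j) * B e j) \<partial>\<Omega>) =
      mean_step n E \<theta> (\<lambda>j. \<integral>e. B e j \<partial>\<Omega>) i"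
proof -
  show "integrable \<Omega> (\<lambda>e. \<Sum>j<n. A (e (Suc t)) $$ (i, j) * B e j)"
    by (intro Bochner_Integration.integrable_sum integrable_next_step_mult[where A = "\<lambda>e. A e $$ (i, _)"] B) auto
  define b where "b j = (\<integral>e. B e j \<partial>\<Omega>)" for j
  have "(\<integral>e. (\<Sum>j<n. A (e (Suc t)) $$ (i, j) * B e j) \<partial>\<Omega>) =
      (\<Sum>j<n. \<integral>e. A (e (Suc t)) $$ (i, j) * B e j \<partial>\<Omega>)"
    by (intro Bochner_Integration.integral_sum integrable_next_step_mult[where A = "\<lambda>e. A e $$ (i, _)"] B) auto
  also have "\<dots> = (\<Sum>j<n. (\<Sum>e\<in>E. edge_prob n E e * A e $$ (i, j)) * b j)"
    unfolding b_def
    by (intro sum.cong refl integral_next_step_mult[where A = "\<lambda>e. A e $$ (i, _)"] B) auto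
  \<comment> \<open>Exchanging the sums lets each single-edge matrix act on the vector
    \<open>b\<close> of expectations.\<close>
  also have "\<dots> = (\<Sum>e\<in>E. edge_prob n E e * (\<Sum>j<n. A e $$ (i, j) * b j))"
    unfolding sum_distrib_left sum_distrib_right by (subst sum.swap) (simp add: mult_ac)
  also have "\<dots> = (\<Sum>e\<in>E. edge_prob n E e * (b i - \<theta> * lap n e b i))"
  proof (intro sum.cong refl arg_cong2[of _ _ _ _ "(*)"])
    fix e assume e: "e \<in> E"
    have "(\<Sum>j<n. A e $$ (i, j) * b j) =
        (\<Sum>j<n. of_bool (j = i) * b j - \<theta> * (edge_laplacian n e $$ (i, j) * b j))"
      by (intro sum.cong refl) (simp add: A e left_diff_distrib)
    then show "(\<Sum>j<n. A e $$ (i, j) * b j) = b i - \<theta> * lap n e b i"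
      using assms(1) by (simp add: sum_subtractf sum_of_bool_mult lap_def sum_distrib_left)
  qed
  also have "\<dots> = mean_step n E \<theta> b i" by (rule mean_step_eq[symmetric])
  finally show "(\<integral>e. (\<Sum>j<n. A (e (Suc t)) $$ (i, j) * B e j) \<partial>\<Omega>) =
      mean_step n E \<theta> (\<lambda>j. \<integral>e. B e j \<partial>\<Omega>) i"
    unfolding b_def .
qed

end

section \<open>Convergence\<close>

context gossip_graph
begin

lemma expected_swapped_obs:
  assumes "k < n"
  shows "integrable \<Omega> (\<lambda>e. swapped_obs n h e s $ k)"
    and "(\<integral>e. swapped_obs n h e s $ k \<partial>\<Omega>) = (mean_step n E 1 ^^ s) h k"
proof -
  interpret prob_space \<Omega> by (rule prob_space_edge_sequences)
  have "integrable \<Omega> (\<lambda>e. swapped_obs n h e s $ k) \<and>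
      (\<integral>e. swapped_obs n h e s $ k \<partial>\<Omega>) = (mean_step n E 1 ^^ s) h k"
    using assms
  proof (induction s arbitrary: k)
    case (Suc s)
    have entry: "swapping_matrix n e $$ (k, j) = of_bool (j = k) - 1 * edge_laplacian n e $$ (k, j)"
      if "j < n" for e j
      using that Suc.prems edge_laplacian_carrier[of n e] by (auto simp: swapping_matrix_def)
    have "step_adapted s (\<lambda>e. swapped_obs n h e s $ j)" if "j < n" for j
      using that by (intro adapted_swapped_obs) auto
    note step = expected_matrix_mult[where A = "swapping_matrix n" and \<theta> = 1 and t = s
        and B = "\<lambda>e j. swapped_obs n h e s $ j", OF Suc.prems entry this]
    show ?case
      unfolding swapped_obs_Suc_index[OF Suc.prems]
      using step Suc.IH Suc.prems by (auto intro!: mean_step_cong)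
  qed (simp add: prob_space)
  then show "integrable \<Omega> (\<lambda>e. swapped_obs n h e s $ k)"
    "(\<integral>e. swapped_obs n h e s $ k \<partial>\<Omega>) = (mean_step n E 1 ^^ s) h k"
    by simp_all
qed

text \<open>The comparison is not linear in the swapped observations. Since swaps permute entries,
  it can be applied to the initial data instead, which leaves a linear evolution of an indicator
  vector.\<close>

lemma expected_comparison:
  assumes "k < n"
  shows "(\<integral>e. of_bool (X k > swapped_obs n X e s $ k) \<partial>\<Omega>) =
    (mean_step n E 1 ^^ s) (\<lambda>l. of_bool (X k > X l)) k"
proof -
  have adapted: "step_adapted s (\<lambda>e. swapped_obs n Y e s $ k)" for Y
    using assms by (intro adapted_swapped_obs) auto
  have "(\<integral>e. of_bool (X k > swapped_obs n X e s $ k) \<partial>\<Omega>) =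
      (\<integral>e. swapped_obs n (\<lambda>l. of_bool (X k > X l)) e s $ k \<partial>\<Omega>)"
  proof (rule integral_cong_AE)
    show "(\<lambda>e. of_bool (X k > swapped_obs n X e s $ k) :: real) \<in> borel_measurable \<Omega>"
      "(\<lambda>e. swapped_obs n (\<lambda>l. of_bool (X k > X l)) e s $ k) \<in> borel_measurable \<Omega>"
      unfolding edge_sequences_def
      by (intro adapted_borel_measurable[where t = s] adapted_of_bool_less adapted)+
    show "AE e in \<Omega>. of_bool (X k > swapped_obs n X e s $ k) =
        swapped_obs n (\<lambda>l. of_bool (X k > X l)) e s $ k"
      using AE_edges
    proof eventually_elim
      case (elim e)
      have "e s \<subseteq> {..<n} \<and> card (e s) = 2" if "s \<ge> 1" for s
        using elim that simple by (auto simp: simple_graph_def)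
      from swapped_obs_map[OF this assms, where h = "\<lambda>y. of_bool (X k > y)"]
      show ?case by simp
    qed
  qed
  then show ?thesis using expected_swapped_obs(2)[OF assms] by simp
qed

lemma integrable_rank_estimate:
  assumes "k < n" "t \<ge> 1"
  shows "integrable \<Omega> (\<lambda>e. rank_estimate n X e k t)"
proof (rule integrable_bounded)
  show "step_adapted t (\<lambda>e. rank_estimate n X e k t)"
    using assms by (intro adapted_rank_estimate) auto
  show "\<bar>rank_estimate n X e k t\<bar> \<le> 1 + real n" for e
    using rank_estimate_nonneg_le[OF assms(2), of n X e k] by simp
qed

lemma expected_rank_estimate:
  assumes "k < n" "t \<ge> 1"
  shows "(\<integral>e. rank_estimate n X e k t \<partial>\<Omega>) =
    1 + real n / real t * (\<Sum>s<t. (mean_step n E 1 ^^ s) (\<lambda>l. of_bool (X k > X l)) k)"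
proof -
  interpret prob_space \<Omega> by (rule prob_space_edge_sequences)
  have int: "integrable \<Omega> (\<lambda>e. of_bool (X k > swapped_obs n X e s $ k) :: real)" for s
    using assms(1) by (intro integrable_bounded[of s _ 1] adapted_of_bool_less adapted_swapped_obs) auto
  have "(\<integral>e. rank_estimate n X e k t \<partial>\<Omega>) =
      1 + real n / real t * (\<integral>e. (\<Sum>s=1..t. of_bool (X k > swapped_obs n X e (s - 1) $ k)) \<partial>\<Omega>)"
    unfolding rank_estimate_def
    by (subst Bochner_Integration.integral_add[OF integrable_const
          integrable_mult_right[OF Bochner_Integration.integrable_sum[OF int]]])
      (simp add: prob_space del: sum_of_bool_eq)
  also have "(\<integral>e. (\<Sum>s=1..t. of_bool (X k > swapped_obs n X e (s - 1) $ k) :: real) \<partial>\<Omega>) =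
      (\<Sum>s=1..t. \<integral>e. of_bool (X k > swapped_obs n X e (s - 1) $ k) \<partial>\<Omega>)"
    by (intro Bochner_Integration.integral_sum int)
  also have "\<dots> = (\<Sum>s=1..t. (mean_step n E 1 ^^ (s - 1)) (\<lambda>l. of_bool (X k > X l)) k)"
    by (intro sum.cong refl expected_comparison assms(1))
  also have "\<dots> = (\<Sum>s<t. (mean_step n E 1 ^^ s) (\<lambda>l. of_bool (X k > X l)) k)"
    by (rule sum.reindex_bij_witness[of _ Suc "\<lambda>s. s - 1"]) auto
  finally show ?thesis .
qed

text \<open>The rank is \<open>1 + n * m\<close>, where \<open>m\<close> is the mean of the
  indicator vector \<open>h\<close>. The error is thus \<open>n / t\<close> times a partial sum for
  the centered vector \<open>c\<close>, bounded by \<open>nrm_partial_sums_le\<close>.\<close>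

lemma expected_rank_estimate_error:
  assumes G: "G \<ge> 1" "\<forall>x. (\<Sum>i<n. x i) = 0 \<longrightarrow> (\<Sum>i<n. (x i)\<^sup>2) \<le> G * dirichlet n E x"
    and k: "k < n" and t: "t \<ge> 1"
  shows "\<bar>(\<integral>e. rank_estimate n X e k t \<partial>\<Omega>) - real (obs_rank n X k)\<bar> \<le> 2 * G * (real n)\<^sup>2 / real t"
proof -
  define h where "h = (\<lambda>l. of_bool (X k > X l) :: real)"
  define m where "m = (\<Sum>l<n. h l) / real n"
  define c where "c = (\<lambda>l. h l - m)"
  have m: "0 \<le> m" "m \<le> 1"
    using sum_mono[of "{..<n}" h "\<lambda>_. 1"] n
    by (auto simp: m_def h_def sum_nonneg divide_le_eq simp del: sum_of_bool_eq)
  have "(\<Sum>l<n. c l) = 0" using n by (simp add: c_def m_def sum_subtractf)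
  then have "nrm (\<lambda>i. \<Sum>s<t. (mean_step n E 1 ^^ s) c i) \<le> 2 * G * nrm c"
    by (rule nrm_partial_sums_le[OF G])
  moreover have "nrm c \<le> (\<Sum>l<n. \<bar>c l\<bar>)" by (rule L2_set_le_sum_abs)
  \<comment> \<open>The entries of \<open>h\<close> and the mean \<open>m\<close> lie in [0, 1], so
    each entry of \<open>c\<close> has absolute value at most 1.\<close>
  moreover have "(\<Sum>l<n. \<bar>c l\<bar>) \<le> (\<Sum>l<n. 1)"
    using m by (intro sum_mono) (auto simp: c_def h_def)
  moreover have "\<bar>\<Sum>s<t. (mean_step n E 1 ^^ s) c k\<bar> \<le> nrm (\<lambda>i. \<Sum>s<t. (mean_step n E 1 ^^ s) c i)"
    using member_le_L2_set[of "{..<n}" k "\<lambda>i. \<bar>\<Sum>s<t. (mean_step n E 1 ^^ s) c i\<bar>"] k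
    by (simp add: L2_set_def)
  ultimately have "\<bar>\<Sum>s<t. (mean_step n E 1 ^^ s) c k\<bar> \<le> 2 * G * nrm c" "nrm c \<le> real n"
    by simp_all
  moreover from this(2) have "2 * G * nrm c \<le> 2 * G * real n"
    using G(1) by (intro mult_left_mono) simp_all
  ultimately have bound: "\<bar>\<Sum>s<t. (mean_step n E 1 ^^ s) c k\<bar> \<le> 2 * G * real n"
    by linarith
  \<comment> \<open>Every power fixes the constant part, which contributes \<open>m\<close> in each
    of the \<open>t\<close> terms.\<close>
  have "(\<Sum>s<t. (mean_step n E 1 ^^ s) h k) = (\<Sum>s<t. (mean_step n E 1 ^^ s) c k) + real t * m"
    using mean_step_funpow_diff_const[OF k, where \<theta> = 1 and x = h and c = m] by (simp add: c_def sum_subtractf)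
  moreover have "real (obs_rank n X k) = 1 + real n * m"
    using n by (simp add: obs_rank_def m_def h_def)
  ultimately have "(\<integral>e. rank_estimate n X e k t \<partial>\<Omega>) - real (obs_rank n X k) =
      real n / real t * (\<Sum>s<t. (mean_step n E 1 ^^ s) c k)"
    using t expected_rank_estimate[OF k t, of X] by (simp add: h_def[symmetric] field_simps)
  then have "\<bar>(\<integral>e. rank_estimate n X e k t \<partial>\<Omega>) - real (obs_rank n X k)\<bar> =
      real n / real t * \<bar>\<Sum>s<t. (mean_step n E 1 ^^ s) c k\<bar>"
    by (simp add: abs_mult)
  also have "\<dots> \<le> real n / real t * (2 * G * real n)"
    by (intro mult_left_mono bound) simp
  finally show ?thesis by (simp add: power2_eq_square mult_ac)
qed

lemma integrable_gossip_weight: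
  assumes "k < n"
  shows "integrable \<Omega> (\<lambda>e. gossip_weight n (\<lambda>x. x) X e k t)"
  using integrable_rank_estimate[OF assms, of t X] by (cases "t = 0") (auto simp: gossip_weight_def)

lemma integrable_gossip_increment:
  assumes "k < n"
  shows "integrable \<Omega> (\<lambda>e. gossip_increment n (\<lambda>x. x) X e k t)"
  unfolding gossip_increment_def
  by (intro Bochner_Integration.integrable_diff integrable_gossip_weight assms)

text \<open>The vector to be averaged, including the new increment, is adapted to the first
  \<open>t\<close> edges, so \<open>expected_matrix_mult\<close> applies with \<theta> =
  1/2.\<close>

lemma expected_gossip_estimate_Suc:
  assumes "k < n"
  shows "integrable \<Omega> (\<lambda>e. gossip_estimate n (\<lambda>x. x) g X e t $ k)"
    and "(\<integral>e. gossip_estimate n (\<lambda>x. x) g X e (Suc t) $ k \<partial>\<Omega>) = mean_step n E (1 / 2)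
      (\<lambda>j. (\<integral>e. gossip_estimate n (\<lambda>x. x) g X e t $ j \<partial>\<Omega>) +
        (\<integral>e. gossip_increment n (\<lambda>x. x) X e j (Suc t) \<partial>\<Omega>) * g (X j)) k"
proof -
  define B where "B t e j = gossip_estimate n (\<lambda>x. x) g X e t $ j +
    gossip_increment n (\<lambda>x. x) X e j (Suc t) * g (X j)" for t e j
  have adapted: "step_adapted t (\<lambda>e. B t e j)" if "j < n" for t j
    unfolding B_def using that
    by (intro adapted_add adapted_mult adapted_const adapted_gossip_estimate adapted_gossip_increment) auto
  have entry: "averaging_matrix n e $$ (k, j) = of_bool (j = k) - 1 / 2 * edge_laplacian n e $$ (k, j)"
    if "k < n" "j < n" for e j k
    using that edge_laplacian_carrier[of n e] by (auto simp: averaging_matrix_def)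
  have int: "integrable \<Omega> (\<lambda>e. gossip_estimate n (\<lambda>x. x) g X e t $ k)" if "k < n" for t k
    using that
  proof (induction t arbitrary: k)
    case (Suc t)
    have "integrable \<Omega> (\<lambda>e. B t e j)" if "j < n" for j
      unfolding B_def using that
      by (intro Bochner_Integration.integrable_add integrable_mult_left Suc.IH integrable_gossip_increment)
    from expected_matrix_mult(1)[where A = "averaging_matrix n" and B = "B t",
        OF Suc.prems entry[OF Suc.prems] adapted this]
    show ?case unfolding gossip_estimate_Suc_index[OF Suc.prems] B_def .
  qed simp
  then show "integrable \<Omega> (\<lambda>e. gossip_estimate n (\<lambda>x. x) g X e t $ k)" using assms .
  have intB: "integrable \<Omega> (\<lambda>e. B t e j)" if "j < n" for j
    unfolding B_def using that
    by (intro Bochner_Integration.integrable_add integrable_mult_left int integrable_gossip_increment)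
  have "(\<integral>e. gossip_estimate n (\<lambda>x. x) g X e (Suc t) $ k \<partial>\<Omega>) =
      mean_step n E (1 / 2) (\<lambda>j. \<integral>e. B t e j \<partial>\<Omega>) k"
    unfolding gossip_estimate_Suc_index[OF assms]
    using expected_matrix_mult(2)[where A = "averaging_matrix n" and B = "B t",
        OF assms entry[OF assms] adapted intB]
    by (simp add: B_def)
  also have "\<dots> = mean_step n E (1 / 2)
      (\<lambda>j. (\<integral>e. gossip_estimate n (\<lambda>x. x) g X e t $ j \<partial>\<Omega>) +
        (\<integral>e. gossip_increment n (\<lambda>x. x) X e j (Suc t) \<partial>\<Omega>) * g (X j)) k"
    unfolding B_def using assms
    by (intro mean_step_cong) (simp_all add: int integrable_gossip_increment)
  finally show "(\<integral>e. gossip_estimate n (\<lambda>x. x) g X e (Suc t) $ k \<partial>\<Omega>) = mean_step n E (1 / 2)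
      (\<lambda>j. (\<integral>e. gossip_estimate n (\<lambda>x. x) g X e t $ j \<partial>\<Omega>) +
        (\<integral>e. gossip_increment n (\<lambda>x. x) X e j (Suc t) \<partial>\<Omega>) * g (X j)) k" .
qed

text \<open>Averaging preserves the sum of the entries, so only the increments change it, and these
  telescope to the current weight.\<close>

lemma sum_expected_gossip_estimate:
  "(\<Sum>k<n. \<integral>e. gossip_estimate n (\<lambda>x. x) g X e t $ k \<partial>\<Omega>) =
    (\<Sum>k<n. (\<integral>e. gossip_weight n (\<lambda>x. x) X e k t \<partial>\<Omega>) * g (X k))"
proof (induction t)
  case (Suc t)
  let ?z = "\<lambda>t k. \<integral>e. gossip_estimate n (\<lambda>x. x) g X e t $ k \<partial>\<Omega>"
  let ?d = "\<lambda>k. \<integral>e. gossip_increment n (\<lambda>x. x) X e k (Suc t) \<partial>\<Omega>"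
  let ?w = "\<lambda>t k. \<integral>e. gossip_weight n (\<lambda>x. x) X e k t \<partial>\<Omega>"
  have "(\<Sum>k<n. ?z (Suc t) k) = (\<Sum>k<n. mean_step n E (1 / 2) (\<lambda>j. ?z t j + ?d j * g (X j)) k)"
    by (intro sum.cong refl expected_gossip_estimate_Suc(2)) simp
  also have "\<dots> = (\<Sum>k<n. ?z t k) + (\<Sum>k<n. ?d k * g (X k))"
    by (simp add: sum_mean_step sum.distrib)
  also have "(\<Sum>k<n. ?d k * g (X k)) = (\<Sum>k<n. ?w (Suc t) k * g (X k)) - (\<Sum>k<n. ?w t k * g (X k))"
    unfolding sum_subtractf[symmetric] gossip_increment_def
    by (intro sum.cong refl) (simp add: integrable_gossip_weight left_diff_distrib)
  finally show ?case using Suc.IH by simp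
qed (simp add: gossip_weight_def)

text \<open>With \<open>m\<close> the mean of the expected estimate, the error splits into the
  centered part (\<open>C1\<close>) and the constant offset between \<open>m\<close> and the
  statistic (\<open>C2\<close>). The constant is chosen before \<open>X\<close> and
  \<open>S\<close>.\<close>

lemma expected_gossip_estimate_error:
  "\<exists>C. \<forall>X S t. t \<ge> 1 \<longrightarrow>
    euclidean_norm (expected_gossip_estimate n E (\<lambda>x. x) (indicator S) X t
      - wilcoxon n X S \<cdot>\<^sub>v vec n (\<lambda>_. 1)) \<le> C / real t"
proof -
  obtain G where G: "G \<ge> 1" "\<forall>x. (\<Sum>i<n. x i) = 0 \<longrightarrow> (\<Sum>i<n. (x i)\<^sup>2) \<le> G * dirichlet n E x"
    using poincare_inequality by blast
  \<comment> \<open>Each outer factor \<open>n\<close> in \<open>D\<close> and \<open>C2\<close>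
    comes from bounding the Euclidean norm by the sum of absolute values. The rest of
    \<open>D\<close> bounds one increment; in \<open>C2\<close>, the inner \<open>n\<close> counts
    nodes and the remainder is the rank error.\<close>
  define D where "D = real n * (real n * (1 + real n))"
  define C1 where "C1 = 2 * D / (1 - sqrt (1 - 1 / (2 * G)))\<^sup>2"
  define C2 where "C2 = real n * (real n * (2 * G * (real n)\<^sup>2))"
  have "euclidean_norm (expected_gossip_estimate n E (\<lambda>x. x) (indicator S) X t
      - wilcoxon n X S \<cdot>\<^sub>v vec n (\<lambda>_. 1)) \<le> (C1 + C2) / real t"
    if t: "t \<ge> 1" for X :: "nat \<Rightarrow> real" and S t
  proof -
    define g where "g = (indicator S :: real \<Rightarrow> real)"
    have g: "\<bar>g x\<bar> \<le> 1" for x by (simp add: g_def indicator_def)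
    define z where "z t k = (\<integral>e. gossip_estimate n (\<lambda>x. x) g X e t $ k \<partial>\<Omega>)" for t k
    define d where "d t k = (\<integral>e. gossip_increment n (\<lambda>x. x) X e k t \<partial>\<Omega>) * g (X k)" for t k
    define w where "w = wilcoxon n X S"
    define m where "m = (\<Sum>k<n. z t k) / real n"
    have d: "nrm (d (Suc t)) \<le> D / real (Suc t)" for t
    proof -
      have "\<bar>d (Suc t) k\<bar> \<le> real n * (1 + real n) / real (Suc t)" if k: "k < n" for k
      proof -
        interpret prob_space \<Omega> by (rule prob_space_edge_sequences)
        have "\<bar>\<integral>e. gossip_increment n (\<lambda>x. x) X e k (Suc t) \<partial>\<Omega>\<bar> \<le>
            (\<integral>e. \<bar>gossip_increment n (\<lambda>x. x) X e k (Suc t)\<bar> \<partial>\<Omega>)"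
          by (rule integral_abs_bound)
        also have "\<dots> \<le> (\<integral>e. real n * (1 + real n) / real (Suc t) \<partial>\<Omega>)"
          by (intro integral_mono integrable_abs integrable_gossip_increment k
              gossip_increment_abs_le integrable_const)
        finally have "\<bar>\<integral>e. gossip_increment n (\<lambda>x. x) X e k (Suc t) \<partial>\<Omega>\<bar> \<le>
            real n * (1 + real n) / real (Suc t)" by (simp add: prob_space)
        then show ?thesis
          using mult_mono[OF _ g[of "X k"]] by (fastforce simp: d_def abs_mult)
      qed
      then have "(\<Sum>k<n. \<bar>d (Suc t) k\<bar>) \<le> (\<Sum>k<n. real n * (1 + real n) / real (Suc t))"
        by (intro sum_mono) simp
      with L2_set_le_sum_abs[of "d (Suc t)" "{..<n}"] show ?thesis by (simp add: D_def)
    qed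
    have "nrm (\<lambda>i. z t i - m) \<le> C1 / real t"
      unfolding m_def C1_def
    proof (rule averaging_recursion_bound[OF G d _ _ t])
      show "z 0 i = 0" if "i < n" for i using that by (simp add: z_def)
      show "z (Suc t) i = mean_step n E (1 / 2) (\<lambda>j. z t j + d (Suc t) j) i" if "i < n" for t i
        unfolding z_def d_def by (rule expected_gossip_estimate_Suc(2)[OF that])
    qed
    moreover have "nrm (\<lambda>_. w - m) \<le> C2 / real t"
    proof -
      \<comment> \<open>The factor \<open>n\<close> in the weights cancels the division by
        \<open>n\<close> in the mean.\<close>
      have "m = (\<Sum>k<n. (\<integral>e. rank_estimate n X e k t \<partial>\<Omega>) * g (X k))"
        using t n unfolding m_def z_def sum_expected_gossip_estimate
        by (simp add: gossip_weight_def sum_divide_distrib)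
      moreover have "w = (\<Sum>k<n. real (obs_rank n X k) * g (X k))"
        by (simp add: w_def wilcoxon_def g_def indicator_def of_bool_def)
      ultimately have "\<bar>m - w\<bar> =
          \<bar>\<Sum>k<n. ((\<integral>e. rank_estimate n X e k t \<partial>\<Omega>) - real (obs_rank n X k)) * g (X k)\<bar>"
        by (simp add: sum_subtractf left_diff_distrib)
      also have "\<dots> \<le> (\<Sum>k<n. 2 * G * (real n)\<^sup>2 / real t * 1)"
        by (intro order_trans[OF sum_abs] sum_mono, unfold abs_mult, intro mult_mono g
            expected_rank_estimate_error[OF G _ t]) (use G(1) in auto)
      also have "\<dots> = real n * (2 * G * (real n)\<^sup>2) / real t" by simp
      finally have "real n * \<bar>m - w\<bar> \<le> real n * (real n * (2 * G * (real n)\<^sup>2) / real t)"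
        by (rule mult_left_mono) simp
      moreover have "nrm (\<lambda>_. w - m) \<le> real n * \<bar>m - w\<bar>"
        using L2_set_le_sum_abs[of "\<lambda>_. w - m" "{..<n}"] by (simp add: abs_minus_commute)
      ultimately show ?thesis by (simp add: C2_def)
    qed
    ultimately have "nrm (\<lambda>i. (z t i - m) - (w - m)) \<le> C1 / real t + C2 / real t"
      using L2_set_diff_le[of "\<lambda>i. z t i - m" "\<lambda>_. w - m" "{..<n}"] by linarith
    then show ?thesis
      by (simp add: euclidean_norm_def expected_gossip_estimate_def scalar_prod_def L2_set_def
          lessThan_atLeast0 power2_eq_square z_def w_def g_def add_divide_distrib)
  qed
  then show ?thesis by blast
qed

end

section \<open>A constant uniform over all graphs\<close>

theorem theorem2:
  fixes n :: nat
  assumes "n \<ge> 2"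
  shows "\<exists>K::real. K > 0 \<and>
    (\<forall>(E :: nat set set) (X :: nat \<Rightarrow> real) (S1 :: real set) (S2 :: real set).
       simple_graph n E \<longrightarrow> connected_graph n E \<longrightarrow> \<not> bipartite_graph n E \<longrightarrow>
       inj_on X {..<n} \<longrightarrow> X ` {..<n} = S1 \<union> S2 \<longrightarrow> S1 \<inter> S2 = {} \<longrightarrow>
       (\<exists>T::nat. \<forall>t>T.
          euclidean_norm
            (expected_gossip_estimate n E (\<lambda>x. x) (indicator S1) X t
              - wilcoxon n X S1 \<cdot>\<^sub>v vec n (\<lambda>_. 1))
          \<le> K / ((second_smallest_eigenvalue (weighted_laplacian n E))\<^sup>2 * real t)))"
proof -
  let ?err = "\<lambda>E X S t. euclidean_norm (expected_gossip_estimate n E (\<lambda>x. x) (indicator S) X t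
    - wilcoxon n X S \<cdot>\<^sub>v vec n (\<lambda>_. 1))"
  let ?c = "\<lambda>E. second_smallest_eigenvalue (weighted_laplacian n E)"
  define \<G> where "\<G> = {E. simple_graph n E \<and> connected_graph n E}"
  have graph: "gossip_graph n E" if "E \<in> \<G>" for E
    using that assms by (simp add: \<G>_def gossip_graph_def)
  have "\<G> \<subseteq> Pow (Pow {..<n})" by (auto simp: \<G>_def simple_graph_def)
  then have fin: "finite \<G>" by (rule finite_subset) simp
  have "\<forall>E\<in>\<G>. \<exists>C. \<forall>X S t. t \<ge> 1 \<longrightarrow> ?err E X S t \<le> C / real t"
    using gossip_graph.expected_gossip_estimate_error[OF graph] by blast
  then obtain C where C: "\<And>E X S t. E \<in> \<G> \<Longrightarrow> t \<ge> 1 \<Longrightarrow> ?err E X S t \<le> C E / real t"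
    by metis
  \<comment> \<open>The sum over the finitely many graphs dominates each single term, hence
    \<open>C E\<close> times the squared eigenvalue of \<open>E\<close>; the 1 makes
    \<open>K\<close> positive.\<close>
  define K where "K = 1 + (\<Sum>E\<in>\<G>. \<bar>C E\<bar> * (?c E)\<^sup>2)"
  have "?err E X S1 t \<le> K / ((?c E)\<^sup>2 * real t)" if E: "E \<in> \<G>" and t: "t > 0" for E X S1 t
  proof -
    have c: "(?c E)\<^sup>2 > 0"
      using gossip_graph.second_smallest_eigenvalue_weighted_laplacian[OF graph[OF E]] by simp
    have "C E * (?c E)\<^sup>2 \<le> \<bar>C E\<bar> * (?c E)\<^sup>2" by (intro mult_right_mono) simp_all
    also have "\<dots> \<le> (\<Sum>E\<in>\<G>. \<bar>C E\<bar> * (?c E)\<^sup>2)"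
      by (rule member_le_sum[OF E _ fin]) simp
    finally have "C E \<le> K / (?c E)\<^sup>2" using c by (simp add: K_def pos_le_divide_eq)
    then have "C E / real t \<le> K / (?c E)\<^sup>2 / real t" by (rule divide_right_mono) simp
    with C[OF E, where t = t and X = X and S = S1] t show ?thesis by simp
  qed
  moreover have "K > 0" unfolding K_def by (intro add_pos_nonneg sum_nonneg) auto
  ultimately show ?thesis
    \<comment> \<open>The estimate holds from \<open>t = 1\<close> on, so the threshold is
      0.\<close>
    by (intro exI[of _ K] conjI allI impI exI[of _ 0]) (auto simp: \<G>_def)
qed

end
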